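(* Let $X$ be a max-linear Bayesian network over a directed acyclic graph $\mathcal{D}=(V,E)$ with fixed coefficient matrix $C$. Let $K\subseteq V$ and let $\mathcal{C}(X_K=x_K)$ be the source DAG of the possible context $\{X_K=x_K\}$. Then for all $I,J\subseteq V$ such that $I,J,K$ are pairwise disjoint: if there is no $*$-connecting path relative to $K$ between a node of $I$ and a node of $J$ in $\mathcal{C}(X_K=x_K)$, then $X_I$ and $X_J$ are conditionally independent given $X_K=x_K$.
   Context: Max-linear Bayesian network: $V=\{1,\dots,d\}$, $\mathcal{D}=(V,E)$ is a directed acyclic graph (DAG), $C=(c_{ij})\in[0,\infty)^{d\times d}$ with $c_{ij}>0$ if and only if $j\to i\in E$. The innovations $Z_1,\dots,Z_d$ are independent with atom-free distributions having support $(0,\infty)$; the probability space is $(0,\infty)^V$ with $Z$ the coordinate vector. $X_i=\max\{Z_i,\max_{j\to i\in E}c_{ij}X_j\}$. Kleene star: $c^*_{ii}=1$, and for $i\ne j$, $c^*_{ij}$ is the maximum over all directed paths from $j$ to $i$ in $\mathcal{D}$ of the product of the edge weights ($0$ if none). Then $X_i=\max_jc^*_{ij}Z_j$. Impact graphs: $G(z)$ is the directed graph on $V$ with an edge $j\to i$ ($i\ne j$) iff $\max_vc^*_{iv}z_v=c^*_{ij}z_j$. $\mathcal{E}(g)=\{z:G(z)=g\}$, and $\mathfrak{G}$ is the set of graphs $g$ with $\mathbb{P}(\mathcal{E}(g))>0$. Every $g\in\mathfrak{G}$ is a galaxy: a disjoint union of stars (rooted trees of height at most one, single nodes allowed, edges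 pointing away from the root). $R(g)$ is its set of roots. Contexts: let $K\subset V$ be nonempty. For $g\in\mathfrak{G}$ let $L_g:(0,\infty)^{R(g)}\to(0,\infty)^V$ be the linear map $L_g(z)_r=z_r$ for $r\in R(g)$ and $L_g(z)_i=c^*_{ir}z_r$ if $r\to i$ in $g$; let $\Pi_K(x)=x_K$. A graph $g\in\mathfrak{G}$ is compatible with $\{X_K=x_K\}$ if (i) $\mathcal{E}(g)\cap\{X_K=x_K\}\neq\emptyset$ and (ii) the rank of $\Pi_K\circ L_g$ is minimal among all $g\in\mathfrak{G}$ satisfying (i). $\mathfrak{G}(X_K=x_K)$ is the set of compatible graphs. The context $\{X_K=x_K\}$ is possible if $\mathfrak{G}(X_K=x_K)\ne\emptyset$, and possible under $g$ if $g\in\mathfrak{G}(X_K=x_K)$. Constant nodes: for a possible context, $K^*$ is the set of $j\in V$ for which there is $x_j^*>0$ such that $\{X_{K\cup j}=x_{K\cup j}\}$ is possible iff $x_j=x_j^*$; for $g\in\mathfrak{G}(X_K=x_K)$, $K^*(g)$ is the set of $j\in V$ for which there is $x^*_j>0$ such that $\{X_{K\cup j}=x_{K\cup j}\}$ is possible under $g$ iff $x_j=x_j^*$. Source DAG: $\mathcal{I}(X_K=x_K)$ is the union of all $g\in\mathfrak{G}(X_K=x_K)$. An edge $j\to i$ of $\mathcal{I}(X_K=x_K)$ is redundant if either $j\in K^*$, or $i\notin K^*$ and $j\in K^*(g)$ for every $g\in\mathfrak{G}(X_K=x_K)$ containing the edge. The source DAG $\mathcal{C}(X_K=x_K)$ is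 $\mathcal{I}(X_K=x_K)$ with all redundant edges removed. For $K=\emptyset$ it is, by convention, the reachability DAG with edges $j\to i$ ($i\ne j$) whenever $c^*_{ij}>0$. $*$-connecting paths: an undirected path between $i$ and $j$ in a DAG on $V$ is $*$-connecting relative to $K$ if, up to exchanging $i$ and $j$, it has one of the following forms, where the nodes are distinct, $k\in K$, and all the other nodes shown are not in $K$: (a) $j\to i$; (b) $j\leftarrow j'\to i$; (c) $j\to k\leftarrow i$; (d) $j\leftarrow j'\to k\leftarrow i$; (e) $j\leftarrow j'\to k\leftarrow i'\to i$. Convention: conditional statements given $X_K=x_K$ refer to a regular conditional distribution given $X_K$, and null sets are disregarded, i.e. assertions are meant for all possible $x_K$ outside a set having probability zero under the law of $X_K$. *)

theory Defs
  imports "HOL-Probability.Probability"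
begin

(* Conventions. The node set V is a finite type 'v. A directed graph on V is a set of pairs;
   (j, i) stands for the edge j \<rightarrow> i. Matrices are indexed as in the recursion, so
   c i j is the weight of the edge j \<rightarrow> i. *)

section \<open>Max-linear Bayesian networks\<close>

definition weighted_dag :: "('v::finite \<times> 'v) set \<Rightarrow> ('v \<Rightarrow> 'v \<Rightarrow> real) \<Rightarrow> bool" where
  "weighted_dag E c \<longleftrightarrow>
     acyclic E \<and> (\<forall>i j. 0 \<le> c i j) \<and> (\<forall>i j. 0 < c i j \<longleftrightarrow> (j, i) \<in> E)"

(* Laws of a single innovation, as measures on the half-line (0,\<infinity>); full support means
   that every nonempty open subset of (0,\<infinity>) is charged. *)
definition innovation_law :: "real measure \<Rightarrow> bool" where
  "innovation_law M \<longleftrightarrow>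
     prob_space M \<and> sets M = sets (restrict_space borel {0<..}) \<and>
     (\<forall>x>0. emeasure M {x} = 0) \<and>
     (\<forall>U. open U \<and> U \<noteq> {} \<and> U \<subseteq> {0<..} \<longrightarrow> 0 < emeasure M U)"

(* The probability space (0,\<infinity>)^V with the innovations Z as independent coordinates. *)
abbreviation innovation_space :: "('v::finite \<Rightarrow> real measure) \<Rightarrow> ('v \<Rightarrow> real) measure" where
  "innovation_space \<mu> \<equiv> PiM UNIV \<mu>"

(* The vector X solving the structural equations at Z = z, by recursion along the DAG;
   see max_linear_eq. *)
definition max_linear ::
  "('v::finite \<times> 'v) set \<Rightarrow> ('v \<Rightarrow> 'v \<Rightarrow> real) \<Rightarrow> ('v \<Rightarrow> real) \<Rightarrow> 'v \<Rightarrow> real" where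
  "max_linear E c z =
     wfrec E (\<lambda>x i. Max (insert (z i) ((\<lambda>j. c i j * x j) ` {j. (j, i) \<in> E})))"

lemma max_linear_eq:
  fixes E :: "('v::finite \<times> 'v) set"
  assumes "acyclic E"
  shows "max_linear E c z i =
    Max (insert (z i) ((\<lambda>j. c i j * max_linear E c z j) ` {j. (j, i) \<in> E}))"
proof -
  have "wf E" using assms by (simp add: finite_acyclic_wf)
  then show ?thesis
    unfolding max_linear_def by (subst wfrec) (auto simp: cut_apply intro!: arg_cong[where f = Max])
qed

fun path_weight :: "('v \<Rightarrow> 'v \<Rightarrow> real) \<Rightarrow> 'v list \<Rightarrow> real" where
  "path_weight c (u # v # p) = c v u * path_weight c (v # p)"
| "path_weight c p = 1"

definition dipaths :: "('v \<times> 'v) set \<Rightarrow> 'v \<Rightarrow> 'v \<Rightarrow> 'v list set" where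
  "dipaths E j i =
     {p. p \<noteq> [] \<and> hd p = j \<and> last p = i \<and> successively (\<lambda>u v. (u, v) \<in> E) p}"

(* For acyclic E on a finite type, the set of directed paths is finite, so Max is meaningful. *)
definition kleene_star ::
  "('v::finite \<times> 'v) set \<Rightarrow> ('v \<Rightarrow> 'v \<Rightarrow> real) \<Rightarrow> 'v \<Rightarrow> 'v \<Rightarrow> real" where
  "kleene_star E c i j =
     (if i = j then 1
      else if dipaths E j i = {} then 0
      else Max (path_weight c ` dipaths E j i))"

section \<open>Impact graphs\<close>

definition impact_graph ::
  "('v::finite \<times> 'v) set \<Rightarrow> ('v \<Rightarrow> 'v \<Rightarrow> real) \<Rightarrow> ('v \<Rightarrow> real) \<Rightarrow> ('v \<times> 'v) set" where
  "impact_graph E c z =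
     {(j, i). i \<noteq> j \<and> Max (range (\<lambda>v. kleene_star E c i v * z v)) = kleene_star E c i j * z j}"

definition impact_event ::
  "('v::finite \<times> 'v) set \<Rightarrow> ('v \<Rightarrow> 'v \<Rightarrow> real) \<Rightarrow> ('v \<times> 'v) set \<Rightarrow> ('v \<Rightarrow> real) set" where
  "impact_event E c g = {z. (\<forall>v. 0 < z v) \<and> impact_graph E c z = g}"

definition impact_graphs ::
  "('v::finite \<times> 'v) set \<Rightarrow> ('v \<Rightarrow> 'v \<Rightarrow> real) \<Rightarrow> ('v \<Rightarrow> real measure) \<Rightarrow> ('v \<times> 'v) set set" where
  "impact_graphs E c \<mu> = {g. 0 < emeasure (innovation_space \<mu>) (impact_event E c g)}"

definition roots :: "('v \<times> 'v) set \<Rightarrow> 'v set" where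
  "roots g = {r. \<forall>j. (j, r) \<notin> g}"

(* The map L_g. It reads only the coordinates in roots g; in a galaxy every other node has
   exactly one parent. *)
definition galaxy_map ::
  "('v::finite \<times> 'v) set \<Rightarrow> ('v \<Rightarrow> 'v \<Rightarrow> real) \<Rightarrow> ('v \<times> 'v) set \<Rightarrow> ('v \<Rightarrow> real) \<Rightarrow> 'v \<Rightarrow> real" where
  "galaxy_map E c g z i =
     (if i \<in> roots g then z i
      else (let r = (THE r. (r, i) \<in> g) in kleene_star E c i r * z r))"

(* The rank of \<Pi>_K \<circ> L_g as a linear map, with \<real>^K embedded in \<real>^V by zero padding. Letting z
   range over \<real>^V instead of \<real>^(roots g) does not change the image. *)
definition context_rank ::
  "('v::finite \<times> 'v) set \<Rightarrow> ('v \<Rightarrow> 'v \<Rightarrow> real) \<Rightarrow> 'v set \<Rightarrow> ('v \<times> 'v) set \<Rightarrow> nat" where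
  "context_rank E c K g =
     dim (range (\<lambda>z :: real ^ 'v. \<chi> i. if i \<in> K then galaxy_map E c g (($) z) i else 0))"

section \<open>Contexts\<close>

(* A context {X_K = x_K} is given by K and a function x of which only the values on K matter. *)
definition context_event ::
  "('v::finite \<times> 'v) set \<Rightarrow> ('v \<Rightarrow> 'v \<Rightarrow> real) \<Rightarrow> 'v set \<Rightarrow> ('v \<Rightarrow> real) \<Rightarrow> ('v \<Rightarrow> real) set" where
  "context_event E c K x = {z. (\<forall>v. 0 < z v) \<and> (\<forall>k\<in>K. max_linear E c z k = x k)}"

definition consistent_graphs ::
  "('v::finite \<times> 'v) set \<Rightarrow> ('v \<Rightarrow> 'v \<Rightarrow> real) \<Rightarrow> ('v \<Rightarrow> real measure) \<Rightarrow>
   'v set \<Rightarrow> ('v \<Rightarrow> real) \<Rightarrow> ('v \<times> 'v) set set" where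
  "consistent_graphs E c \<mu> K x =
     {g \<in> impact_graphs E c \<mu>. impact_event E c g \<inter> context_event E c K x \<noteq> {}}"

definition compatible_graphs ::
  "('v::finite \<times> 'v) set \<Rightarrow> ('v \<Rightarrow> 'v \<Rightarrow> real) \<Rightarrow> ('v \<Rightarrow> real measure) \<Rightarrow>
   'v set \<Rightarrow> ('v \<Rightarrow> real) \<Rightarrow> ('v \<times> 'v) set set" where
  "compatible_graphs E c \<mu> K x =
     {g \<in> consistent_graphs E c \<mu> K x.
        \<forall>g' \<in> consistent_graphs E c \<mu> K x. context_rank E c K g \<le> context_rank E c K g'}"

definition possible_context ::
  "('v::finite \<times> 'v) set \<Rightarrow> ('v \<Rightarrow> 'v \<Rightarrow> real) \<Rightarrow> ('v \<Rightarrow> real measure) \<Rightarrow>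
   'v set \<Rightarrow> ('v \<Rightarrow> real) \<Rightarrow> bool" where
  "possible_context E c \<mu> K x \<longleftrightarrow> compatible_graphs E c \<mu> K x \<noteq> {}"

(* The nodes of K^*: here x' runs over the extensions x_{K \<union> j} of x_K. For j \<in> K the
   only extension is x_K itself, so K \<subseteq> K^* for possible contexts. *)
definition constant_nodes ::
  "('v::finite \<times> 'v) set \<Rightarrow> ('v \<Rightarrow> 'v \<Rightarrow> real) \<Rightarrow> ('v \<Rightarrow> real measure) \<Rightarrow>
   'v set \<Rightarrow> ('v \<Rightarrow> real) \<Rightarrow> 'v set" where
  "constant_nodes E c \<mu> K x =
     {j. \<exists>y>0. \<forall>x'. (\<forall>k\<in>K. x' k = x k) \<longrightarrow>
           (possible_context E c \<mu> (insert j K) x' \<longleftrightarrow> x' j = y)}"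

definition constant_nodes_under ::
  "('v::finite \<times> 'v) set \<Rightarrow> ('v \<Rightarrow> 'v \<Rightarrow> real) \<Rightarrow> ('v \<Rightarrow> real measure) \<Rightarrow>
   'v set \<Rightarrow> ('v \<Rightarrow> real) \<Rightarrow> ('v \<times> 'v) set \<Rightarrow> 'v set" where
  "constant_nodes_under E c \<mu> K x g =
     {j. \<exists>y>0. \<forall>x'. (\<forall>k\<in>K. x' k = x k) \<longrightarrow>
           (g \<in> compatible_graphs E c \<mu> (insert j K) x' \<longleftrightarrow> x' j = y)}"

section \<open>The source DAG and star-connecting paths\<close>

definition context_impact_graph ::
  "('v::finite \<times> 'v) set \<Rightarrow> ('v \<Rightarrow> 'v \<Rightarrow> real) \<Rightarrow> ('v \<Rightarrow> real measure) \<Rightarrow>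
   'v set \<Rightarrow> ('v \<Rightarrow> real) \<Rightarrow> ('v \<times> 'v) set" where
  "context_impact_graph E c \<mu> K x = \<Union> (compatible_graphs E c \<mu> K x)"

definition redundant_edge ::
  "('v::finite \<times> 'v) set \<Rightarrow> ('v \<Rightarrow> 'v \<Rightarrow> real) \<Rightarrow> ('v \<Rightarrow> real measure) \<Rightarrow>
   'v set \<Rightarrow> ('v \<Rightarrow> real) \<Rightarrow> 'v \<Rightarrow> 'v \<Rightarrow> bool" where
  "redundant_edge E c \<mu> K x j i \<longleftrightarrow>
     j \<in> constant_nodes E c \<mu> K x \<or>
     (i \<notin> constant_nodes E c \<mu> K x \<and>
      (\<forall>g \<in> compatible_graphs E c \<mu> K x.
         (j, i) \<in> g \<longrightarrow> j \<in> constant_nodes_under E c \<mu> K x g))"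

definition source_dag ::
  "('v::finite \<times> 'v) set \<Rightarrow> ('v \<Rightarrow> 'v \<Rightarrow> real) \<Rightarrow> ('v \<Rightarrow> real measure) \<Rightarrow>
   'v set \<Rightarrow> ('v \<Rightarrow> real) \<Rightarrow> ('v \<times> 'v) set" where
  "source_dag E c \<mu> K x =
     (if K = {} then {(j, i). i \<noteq> j \<and> 0 < kleene_star E c i j}
      else {(j, i) \<in> context_impact_graph E c \<mu> K x. \<not> redundant_edge E c \<mu> K x j i})"

definition star_path_form :: "('v \<times> 'v) set \<Rightarrow> 'v set \<Rightarrow> 'v \<Rightarrow> 'v \<Rightarrow> bool" where
  "star_path_form G K i j \<longleftrightarrow>
     i \<notin> K \<and> j \<notin> K \<and> i \<noteq> j \<and>
     ((j, i) \<in> G \<or>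
      (\<exists>j'. j' \<notin> K \<and> distinct [i, j, j'] \<and> (j', j) \<in> G \<and> (j', i) \<in> G) \<or>
      (\<exists>k\<in>K. (j, k) \<in> G \<and> (i, k) \<in> G) \<or>
      (\<exists>j'. \<exists>k\<in>K. j' \<notin> K \<and> distinct [i, j, j'] \<and>
         (j', j) \<in> G \<and> (j', k) \<in> G \<and> (i, k) \<in> G) \<or>
      (\<exists>j' i'. \<exists>k\<in>K. j' \<notin> K \<and> i' \<notin> K \<and> distinct [i, j, j', i'] \<and>
         (j', j) \<in> G \<and> (j', k) \<in> G \<and> (i', k) \<in> G \<and> (i', i) \<in> G))"

definition star_connected :: "('v \<times> 'v) set \<Rightarrow> 'v set \<Rightarrow> 'v \<Rightarrow> 'v \<Rightarrow> bool" where
  "star_connected G K i j \<longleftrightarrow> star_path_form G K i j \<or> star_path_form G K j i"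

section \<open>Conditioning\<close>

definition subvector :: "('a \<Rightarrow> 'v \<Rightarrow> real) \<Rightarrow> 'v set \<Rightarrow> 'a \<Rightarrow> 'v \<Rightarrow> real" where
  "subvector X I \<omega> = restrict (X \<omega>) I"

(* \<kappa> is a version of the regular conditional probability P( \<cdot> | Y = y) of the measure P given
   the N-valued random variable Y. *)
definition regular_conditional_prob ::
  "'a measure \<Rightarrow> 'b measure \<Rightarrow> ('a \<Rightarrow> 'b) \<Rightarrow> ('b \<Rightarrow> 'a measure) \<Rightarrow> bool" where
  "regular_conditional_prob P N Y \<kappa> \<longleftrightarrow>
     \<kappa> \<in> measurable N (prob_algebra P) \<and>
     (\<forall>A\<in>sets P. \<forall>B\<in>sets N.
        emeasure P (A \<inter> (Y -` B \<inter> space P)) = (\<integral>\<^sup>+ y\<in>B. emeasure (\<kappa> y) A \<partial>distr P N Y))"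

abbreviation borel_on :: "'v set \<Rightarrow> ('v \<Rightarrow> real) measure" where
  "borel_on I \<equiv> PiM I (\<lambda>_. borel)"

end

theory Submission
  imports Defs
begin

text \<open>
  At a generic outcome every node \<open>i\<close> has a single source, the node whose innovation attains the
  maximum \<open>X i = (MAX j. c\<^sup>* i j * z j)\<close>. Fixing the values on \<open>K\<close> therefore does two things to the
  innovations: it bounds each of them from above, and it forces one innovation per block of \<open>K\<close> to
  lie on its bound, where a block consists of the nodes of \<open>K\<close> that share their source. Which nodes
  of \<open>K\<close> form a block is determined by \<open>x\<close> up to a null set, because two nodes with different sources
  almost surely do not have values in one of the finitely many ratios that a common source would
  produce. The same argument shows that the impact graph of a generic outcome always has minimal
  rank among the graphs consistent with its values on \<open>K\<close> (\<open>generic_compatible\<close>), so given \<open>X\<^sub>K = x\<close>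
  almost every outcome lies in the set \<open>fibre K x\<close> of generic outcomes, all of whose graphs are
  compatible. From there on the source DAG only has to be studied on the fibre.

  Outside \<open>K\<close>, the value at \<open>i\<close> is on the fibre a maximum of a constant and of the innovations at
  \<open>i\<close> and at its parents in the source DAG (\<open>X_on_fibre\<close>): what a redundant edge would contribute is
  a guaranteed minimum of \<open>X i\<close>, hence part of the constant. Conditioning makes innovations dependent
  only if they are alternative sources of the same node of \<open>K\<close>, and then each of them that belongs to
  a nonconstant node has an edge to that node of \<open>K\<close> in the source DAG. The five forms of \<open>*\<close>-connecting paths are exactly the ways in which \<open>i\<close>
  and \<open>j\<close> can use the same innovation or two alternative sources of one node of \<open>K\<close>. If there is no
  such path between \<open>I\<close> and \<open>J\<close>, the innovations split into a group \<open>U\<close> that contains everything \<open>I\<close>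
  uses and its complement that contains everything \<open>J\<close> uses, in such a way that each node of \<open>K\<close>
  has its source in the same group throughout the fibre (\<open>separating_split\<close>).

  What remains is a statement on two independent families \<open>W\<close> and \<open>W'\<close>. On the event that a set
  \<open>L \<subseteq> K\<close> of nodes has its sources in \<open>U\<close> and \<open>K - L\<close> has its sources outside, \<open>X\<^sub>K\<close> consists of a
  function \<open>Y\<close> of \<open>W\<close> and a function \<open>Y'\<close> of \<open>W'\<close>, and the event itself is the intersection of a
  condition on \<open>(W, Y')\<close> and a condition on \<open>(W', Y)\<close>. Given \<open>(Y, Y')\<close> these conditions leave \<open>W\<close> and
  \<open>W'\<close> independent, so they are conditionally independent given \<open>X\<^sub>K\<close> wherever the event has
  conditional probability one (\<open>conditionally_independent_on\<close>).
\<close>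

section \<open>The Kleene star and the max-linear representation\<close>

lemma Max_range_attained:
  fixes f :: "'a::finite \<Rightarrow> 'b::linorder"
  obtains j where "Max (range f) = f j"
proof -
  have "Max (range f) \<in> range f" by (rule Max_in) auto
  then obtain j where "Max (range f) = f j" by (rule imageE)
  then show ?thesis by (rule that)
qed

lemma path_weight_snoc:
  assumes "p \<noteq> []"
  shows "path_weight c (p @ [i]) = path_weight c p * c i (last p)"
  using assms
proof (induction c p rule: path_weight.induct)
  case (1 c u v p)
  then show ?case by (simp add: mult.assoc)
qed auto

lemma dipaths_snoc_iff:
  "p @ [i] \<in> dipaths E j i' \<longleftrightarrow>
     i' = i \<and> (if p = [] then j = i else p \<in> dipaths E j (last p) \<and> (last p, i) \<in> E)"
  by (cases "p = []") (auto simp: dipaths_def successively_append_iff)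

lemma dipaths_trancl:
  assumes "p \<in> dipaths E j i" "v \<in> set (butlast p)"
  shows "(v, i) \<in> E\<^sup>+"
  using assms
proof (induction p arbitrary: i rule: rev_induct)
  case (snoc x p)
  then have x: "x = i" "p \<noteq> []" "p \<in> dipaths E j (last p)" "(last p, i) \<in> E" "v \<in> set p"
    by (auto simp: dipaths_snoc_iff split: if_splits)
  show ?case
  proof (cases "v = last p")
    case False
    then have "v \<in> set (butlast p)"
      using x by (metis append_butlast_last_id rotate1.simps(2) set_ConsD set_rotate1)
    then show ?thesis using snoc.IH x by (meson trancl.trancl_into_trancl)
  qed (use x in auto)
qed auto

lemma dipaths_distinct:
  assumes "acyclic E" "p \<in> dipaths E j i"
  shows "distinct p"
  using assms(2)
proof (induction p arbitrary: i rule: rev_induct)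
  case (snoc x p)
  then have "x \<notin> set p"
    using dipaths_trancl[OF snoc.prems] assms(1) by (auto simp: dipaths_snoc_iff acyclic_def)
  moreover have "distinct p"
    using snoc by (cases "p = []") (auto simp: dipaths_snoc_iff)
  ultimately show ?case by simp
qed auto

lemma finite_dipaths:
  fixes E :: "('v::finite \<times> 'v) set"
  assumes "acyclic E"
  shows "finite (dipaths E j i)"
  by (rule finite_subset[OF _ finite_subset_distinct[of UNIV]])
     (use dipaths_distinct[OF assms] in auto)

locale weighted_network =
  fixes E :: "('v::finite \<times> 'v) set" and c :: "'v \<Rightarrow> 'v \<Rightarrow> real"
  assumes weighted: "weighted_dag E c"
begin

abbreviation cs :: "'v \<Rightarrow> 'v \<Rightarrow> real" where
  "cs \<equiv> kleene_star E c"

lemma acyclic: "acyclic E" and c_nonneg: "0 \<le> c i j"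
  using weighted by (auto simp: weighted_dag_def)

lemma wf_E: "wf E"
  using acyclic by (simp add: finite_acyclic_wf)

lemma dipaths_refl: "dipaths E i i = {[i]}"
proof -
  have "p = [i]" if "p \<in> dipaths E i i" for p
  proof (cases p rule: rev_cases)
    case (snoc q x)
    show ?thesis
    proof (cases "q = []")
      case False
      then have "i \<in> set q" using that snoc by (cases q) (auto simp: dipaths_def)
      then show ?thesis
        using dipaths_trancl[OF that, of i] snoc acyclic by (auto simp: acyclic_def)
    qed (use that snoc in \<open>auto simp: dipaths_def\<close>)
  qed (use that in \<open>auto simp: dipaths_def\<close>)
  then show ?thesis by (auto simp: dipaths_def)
qed

lemma cs_eq_Max:
  "cs i j = (if dipaths E j i = {} then 0 else Max (path_weight c ` dipaths E j i))"
  by (auto simp: kleene_star_def dipaths_refl)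

lemma path_weight_le_cs: "p \<in> dipaths E j i \<Longrightarrow> path_weight c p \<le> cs i j"
  by (auto simp: cs_eq_Max finite_dipaths[OF acyclic])

lemma cs_attained:
  assumes "cs i j \<noteq> 0"
  obtains p where "p \<in> dipaths E j i" "cs i j = path_weight c p"
proof -
  have ne: "dipaths E j i \<noteq> {}" using assms by (auto simp: cs_eq_Max)
  then have "Max (path_weight c ` dipaths E j i) \<in> path_weight c ` dipaths E j i"
    by (intro Max_in) (auto simp: finite_dipaths[OF acyclic])
  then show ?thesis using that ne by (auto simp: cs_eq_Max)
qed

lemma path_weight_nonneg: "0 \<le> path_weight c p"
  by (induction p rule: induct_list012) (auto simp: c_nonneg intro!: mult_nonneg_nonneg)

lemma cs_nonneg: "0 \<le> cs i j"
proof (cases "cs i j = 0")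
  case False
  then obtain p where "cs i j = path_weight c p" by (rule cs_attained)
  then show ?thesis by (simp add: path_weight_nonneg)
qed simp

lemma cs_refl [simp]: "cs i i = 1"
  by (simp add: kleene_star_def)

lemma cs_step:
  assumes "(l, i) \<in> E"
  shows "c i l * cs l j \<le> cs i j"
proof (cases "cs l j = 0")
  case False
  then obtain p where p: "p \<in> dipaths E j l" "cs l j = path_weight c p"
    by (rule cs_attained)
  then have "p \<noteq> []" "last p = l" by (auto simp: dipaths_def)
  then have "p @ [i] \<in> dipaths E j i" "path_weight c (p @ [i]) = c i l * cs l j"
    using p assms by (auto simp: dipaths_snoc_iff path_weight_snoc)
  then show ?thesis using path_weight_le_cs[of "p @ [i]" j i] by simp
qed (simp add: cs_nonneg)

text \<open>An optimal path stays optimal when its last edge is removed, since replacing the rest by a better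
  path would improve the whole.\<close>

lemma cs_last_edge:
  assumes "i \<noteq> j" "cs i j \<noteq> 0"
  obtains l where "(l, i) \<in> E" "cs i j = c i l * cs l j"
proof -
  obtain p where p: "p \<in> dipaths E j i" "cs i j = path_weight c p"
    using assms(2) by (rule cs_attained)
  define q where "q = butlast p"
  have q: "p = q @ [i]"
    unfolding q_def using p(1) append_butlast_last_id[of p] by (simp add: dipaths_def)
  then have qs: "q \<noteq> []" "q \<in> dipaths E j (last q)" "(last q, i) \<in> E"
    using p assms(1) by (auto simp: dipaths_snoc_iff split: if_splits)
  have w: "cs i j = c i (last q) * path_weight c q"
    using p q qs by (simp add: path_weight_snoc)
  then have "cs i j \<le> c i (last q) * cs (last q) j"
    using path_weight_le_cs[OF qs(2)] c_nonneg by (simp add: mult_left_mono)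
  then have "cs i j = c i (last q) * cs (last q) j"
    using cs_step[OF qs(3), of j] by simp
  then show ?thesis using that qs by blast
qed

text \<open>Induction along the DAG, taking off one last edge at a time, replaces the concatenation of paths.\<close>

lemma cs_trans: "cs i j * cs j k \<le> cs i k"
proof (induction i rule: wf_induct_rule[OF wf_E])
  case (1 i)
  show ?case
  proof (cases "i = j \<or> cs i j = 0")
    case False
    then obtain l where l: "(l, i) \<in> E" "cs i j = c i l * cs l j"
      using cs_last_edge[of i j] by blast
    have "cs i j * cs j k = c i l * (cs l j * cs j k)" by (simp add: l)
    also have "\<dots> \<le> c i l * cs l k" by (intro mult_left_mono 1 l c_nonneg)
    also have "\<dots> \<le> cs i k" by (rule cs_step[OF l(1)])
    finally show ?thesis .
  qed (auto simp: cs_nonneg)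
qed

abbreviation X :: "('v \<Rightarrow> real) \<Rightarrow> 'v \<Rightarrow> real" where
  "X \<equiv> max_linear E c"

text \<open>The right-hand side satisfies the structural equations: the last edge of a path that
  realises \<^term>\<open>cs i j\<close> passes the value on from a parent of \<^term>\<open>i\<close>.\<close>

theorem max_linear_eq_Max_cs:
  assumes pos: "\<And>v. 0 < z v"
  shows "X z i = Max (range (\<lambda>j. cs i j * z j))"
proof (induction i rule: wf_induct_rule[OF wf_E])
  case (1 i)
  let ?A = "insert (z i) ((\<lambda>j. c i j * X z j) ` {j. (j, i) \<in> E})"
  have "Max ?A = Max (range (\<lambda>j. cs i j * z j))"
  proof (rule antisym)
    have "c i l * X z l \<le> Max (range (\<lambda>j. cs i j * z j))" if l: "(l, i) \<in> E" for l
    proof -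
      obtain j where j: "X z l = cs l j * z j"
        unfolding 1[OF l] by (rule Max_range_attained)
      have "c i l * X z l = (c i l * cs l j) * z j" by (simp add: j)
      also have "\<dots> \<le> cs i j * z j"
        using cs_step[OF l] pos by (simp add: mult_right_mono less_imp_le)
      also have "\<dots> \<le> Max (range (\<lambda>j. cs i j * z j))" by (intro Max_ge) auto
      finally show ?thesis .
    qed
    moreover have "z i \<le> Max (range (\<lambda>j. cs i j * z j))"
      by (rule Max_ge) (auto intro: image_eqI[of _ _ i])
    ultimately show "Max ?A \<le> Max (range (\<lambda>j. cs i j * z j))" by auto
    have "cs i j * z j \<le> Max ?A" for j
    proof (cases "i = j \<or> cs i j = 0")
      case False
      then obtain l where l: "(l, i) \<in> E" "cs i j = c i l * cs l j"
        using cs_last_edge[of i j] by blast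
      have "cs l j * z j \<le> X z l" using 1[OF l(1)] by simp
      then have "c i l * (cs l j * z j) \<le> c i l * X z l" by (intro mult_left_mono c_nonneg)
      also have "\<dots> \<le> Max ?A" using l by (intro Max_ge) auto
      finally show ?thesis by (simp add: l mult.assoc)
    next
      case True
      have "0 < z i" "z i \<le> Max ?A" using pos by auto
      then have "0 \<le> Max ?A" by linarith
      then show ?thesis using True \<open>z i \<le> Max ?A\<close> by auto
    qed
    then show "Max (range (\<lambda>j. cs i j * z j)) \<le> Max ?A" by (subst Max_le_iff) auto
  qed
  then show ?case by (subst max_linear_eq[OF acyclic])
qed

lemma X_ge: "(\<And>v. 0 < z v) \<Longrightarrow> cs i j * z j \<le> X z i"
  by (simp add: max_linear_eq_Max_cs)

lemma X_pos: "(\<And>v. 0 < z v) \<Longrightarrow> 0 < X z i"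
  using X_ge[of z i i] by (simp add: less_le_trans[of 0 "z i"])

lemma X_attained:
  assumes "\<And>v. 0 < z v"
  obtains j where "X z i = cs i j * z j" "0 < cs i j"
proof -
  obtain j where j: "X z i = cs i j * z j"
    unfolding max_linear_eq_Max_cs[OF assms] by (rule Max_range_attained)
  moreover have "0 < cs i j"
    using j X_pos[of z i] assms cs_nonneg[of i j] by (cases "cs i j = 0") auto
  ultimately show ?thesis using that by blast
qed

section \<open>Generic innovations\<close>

text \<open>The exceptional proportions between two innovations. For \<open>k = k'\<close> and \<open>s = r\<close> they describe ties
  between two candidates for the value at one node. In general they describe the coincidence that the
  values at \<open>k\<close> and \<open>k'\<close>, with sources \<open>r\<close> and \<open>r'\<close>, look as if they came from a common source \<open>s\<close>.
  Division by zero only adds the ratio 0, which positive innovations never have.\<close>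

definition ratios :: "real set" where
  "ratios = range (\<lambda>(k, k', s, r, r'). cs k s * cs k' r' / (cs k' s * cs k r))"

definition generic :: "('v \<Rightarrow> real) \<Rightarrow> bool" where
  "generic z \<longleftrightarrow> (\<forall>v. 0 < z v) \<and> (\<forall>v w. v \<noteq> w \<longrightarrow> (\<forall>t\<in>ratios. z v \<noteq> t * z w))"

text \<open>At a generic point exactly one node qualifies (\<open>src_eqI\<close>).\<close>

definition src :: "('v \<Rightarrow> real) \<Rightarrow> 'v \<Rightarrow> 'v" where
  "src z i = (SOME j. X z i = cs i j * z j)"

lemma finite_ratios: "finite ratios"
  by (simp add: ratios_def)

lemma ratiosI: "cs k s * cs k' r' / (cs k' s * cs k r) \<in> ratios"
  unfolding ratios_def by (rule image_eqI[of _ _ "(k, k', s, r, r')"]) auto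

lemma genericD: "generic z \<Longrightarrow> 0 < z v"
  by (simp add: generic_def)

lemma X_eqI:
  assumes "\<And>v. 0 < z v" "\<And>v. cs i v * z v \<le> cs i j * z j"
  shows "X z i = cs i j * z j"
  using assms by (auto simp: max_linear_eq_Max_cs intro!: Max_eqI)

text \<open>A common source \<^term>\<open>s\<close> would need two different innovations to explain the values at \<^term>\<open>k\<close>
  and \<^term>\<open>k'\<close>.\<close>

lemma generic_cross_tie:
  assumes "generic z" "r \<noteq> r'" "0 < cs k r" "0 < cs k s" "0 < cs k' s"
  shows "cs k r * z r / cs k s \<noteq> cs k' r' * z r' / cs k' s"
proof
  assume "cs k r * z r / cs k s = cs k' r' * z r' / cs k' s"
  then have "z r = (cs k s * cs k' r' / (cs k' s * cs k r)) * z r'"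
    using assms by (simp add: field_simps)
  then show False using assms ratiosI unfolding generic_def by blast
qed

lemma generic_no_tie:
  assumes "generic z" "v \<noteq> w" "0 < cs i v"
  shows "cs i v * z v \<noteq> cs i w * z w"
  using generic_cross_tie[of z v w i v i] assms by (auto simp: field_simps)

lemma X_src:
  assumes "generic z"
  shows "X z i = cs i (src z i) * z (src z i)"
  unfolding src_def by (rule someI_ex) (metis X_attained genericD[OF assms])

lemma cs_src_pos: "generic z \<Longrightarrow> 0 < cs i (src z i)"
  using X_src[of z i] X_pos[of z i] genericD[of z] cs_nonneg[of i "src z i"]
  by (cases "cs i (src z i) = 0") auto

lemma src_eqI:
  assumes "generic z" "X z i = cs i j * z j"
  shows "src z i = j"
  using generic_no_tie[OF assms(1) _ cs_src_pos[OF assms(1)]] X_src[OF assms(1)] assms(2) by metis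

lemma src_less:
  assumes "generic z" "j \<noteq> src z i"
  shows "cs i j * z j < X z i"
  using X_ge[of z i j] src_eqI[OF assms(1), of i j] assms genericD by fastforce

text \<open>Otherwise the value at \<^term>\<open>src z i\<close> would itself be inherited from a third node, and the
  concatenated path would give \<^term>\<open>i\<close> a larger value.\<close>

lemma src_src:
  assumes "generic z"
  shows "src z (src z i) = src z i"
proof (rule ccontr)
  let ?j = "src z i" let ?k = "src z ?j"
  assume "?k \<noteq> ?j"
  then have "cs ?j ?j * z ?j < cs ?j ?k * z ?k"
    using src_less[OF assms, of ?j ?j] by (metis X_src assms)
  then have "cs i ?j * z ?j < cs i ?j * (cs ?j ?k * z ?k)"
    using cs_src_pos[OF assms, of i] by simp
  also have "\<dots> = (cs i ?j * cs ?j ?k) * z ?k" by simp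
  also have "\<dots> \<le> cs i ?k * z ?k"
    using cs_trans genericD[OF assms] by (simp add: mult_right_mono less_imp_le)
  also have "\<dots> \<le> X z i" using genericD[OF assms] by (rule X_ge)
  finally show False using X_src[OF assms, of i] by simp
qed

lemma X_of_source: "generic z \<Longrightarrow> src z j = j \<Longrightarrow> X z j = z j"
  using X_src[of z j] by simp

lemma impact_graph_generic:
  assumes "generic z"
  shows "impact_graph E c z = {(j, i). j \<noteq> i \<and> src z i = j}"
  using src_eqI[OF assms] X_src[OF assms] genericD[OF assms]
  by (auto simp: impact_graph_def max_linear_eq_Max_cs[symmetric])

text \<open>Genericity consists of finitely many strict inequalities and inequations, and that a given
  node is the source of another one is, at a generic point, a matter of strict inequalities as well.\<close>

lemma generic_open:
  assumes "generic z"
  obtains V where "\<forall>v. open (V v) \<and> z v \<in> V v \<and> V v \<subseteq> {0<..}"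
    "\<forall>z'. (\<forall>v. z' v \<in> V v) \<longrightarrow> generic z' \<and> (\<forall>i. src z' i = src z i)"
proof -
  define O1 where "O1 = (\<Inter>v. {z' :: 'v \<Rightarrow> real. 0 < z' v})"
  define O2 where "O2 = (\<Inter>v. \<Inter>w\<in>-{v}. \<Inter>t\<in>ratios. {z' :: 'v \<Rightarrow> real. z' v \<noteq> t * z' w})"
  define O3 where "O3 = (\<Inter>i. \<Inter>j\<in>-{src z i}.
    {z' :: 'v \<Rightarrow> real. cs i j * z' j < cs i (src z i) * z' (src z i)})"
  have "open (O1 \<inter> O2 \<inter> O3)"
    unfolding O1_def O2_def O3_def
    by (intro open_Int open_INT ballI finite_ratios finite open_Collect_less open_Collect_neq
        continuous_intros continuous_on_product_coordinates)
  then have "openin (product_topology (\<lambda>_. euclidean) UNIV) (O1 \<inter> O2 \<inter> O3)"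
    by (simp add: open_fun_def)
  moreover have "z \<in> O1 \<inter> O2 \<inter> O3"
    using assms src_less[OF assms] by (auto simp: O1_def O2_def O3_def generic_def X_src)
  ultimately obtain V where V: "z \<in> PiE UNIV V" "\<And>v. open (V v)" "PiE UNIV V \<subseteq> O1 \<inter> O2 \<inter> O3"
    using product_topology_open_contains_basis[of "\<lambda>_. euclidean" UNIV] by (metis open_openin)
  show ?thesis
  proof (rule that[of "\<lambda>v. V v \<inter> {0<..}"]; intro allI impI)
    fix z' assume z': "\<forall>v. z' v \<in> V v \<inter> {0<..}"
    then have "z' \<in> PiE UNIV V" by (simp add: PiE_UNIV_domain Pi_iff)
    then have O: "z' \<in> O1" "z' \<in> O2" "z' \<in> O3" using V by auto
    then have g: "generic z'" by (auto simp: generic_def O1_def O2_def)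
    have "cs i v * z' v \<le> cs i (src z i) * z' (src z i)" for i v
      using O(3) by (cases "v = src z i") (auto simp: O3_def less_imp_le)
    then have "X z' i = cs i (src z i) * z' (src z i)" for i
      using genericD[OF g] by (intro X_eqI)
    then show "generic z' \<and> (\<forall>i. src z' i = src z i)" using g src_eqI by blast
  qed (use V assms in \<open>auto simp: genericD intro!: open_Int\<close>)
qed

lemma finite_not_generic_update:
  assumes "generic z"
  shows "finite {t. 0 < t \<and> \<not> generic (z(j := t))}"
proof (rule finite_subset)
  show "{t. 0 < t \<and> \<not> generic (z(j := t))} \<subseteq>
      (\<lambda>(r, w). r * z w) ` (ratios \<times> UNIV) \<union> (\<lambda>(r, w). z w / r) ` (ratios \<times> UNIV)"
  proof
    fix t assume "t \<in> {t. 0 < t \<and> \<not> generic (z(j := t))}"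
    then have t: "0 < t" "\<not> generic (z(j := t))" by auto
    then obtain v w r where r: "v \<noteq> w" "r \<in> ratios" "(z(j := t)) v = r * (z(j := t)) w"
      using genericD[OF assms] by (auto simp: generic_def split: if_splits)
    consider "v = j" | "w = j" | "v \<noteq> j" "w \<noteq> j" by blast
    then show "t \<in> (\<lambda>(r, w). r * z w) ` (ratios \<times> UNIV) \<union> (\<lambda>(r, w). z w / r) ` (ratios \<times> UNIV)"
    proof cases
      case 1
      then show ?thesis using r by (auto intro!: image_eqI[of _ _ "(r, w)"])
    next
      case 2
      then have "z v = r * t" using r by auto
      then have "t = z v / r" using genericD[OF assms, of v] by auto
      then show ?thesis using r by (auto intro!: image_eqI[of _ _ "(r, v)"])
    next
      case 3
      then show ?thesis using r assms by (auto simp: generic_def)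
    qed
  qed
qed (simp add: finite_ratios)

lemma generic_update_between:
  assumes "generic z" "0 \<le> a" "a < b"
  obtains t where "a < t" "t < b" "generic (z(j := t))"
proof -
  have "\<not> {a<..<b} \<subseteq> {t. 0 < t \<and> \<not> generic (z(j := t))}"
    using finite_not_generic_update[OF assms(1), of j] infinite_Ioo[OF assms(3)] finite_subset by blast
  then show ?thesis using that assms(2) by auto
qed

end

section \<open>Realisable impact graphs\<close>

locale innovation_network = weighted_network E c
  for E :: "('v::finite \<times> 'v) set" and c :: "'v \<Rightarrow> 'v \<Rightarrow> real" +
  fixes \<mu> :: "'v \<Rightarrow> real measure"
  assumes innovations: "\<And>v. innovation_law (\<mu> v)"
begin

abbreviation P :: "('v \<Rightarrow> real) measure" where
  "P \<equiv> innovation_space \<mu>"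

lemma prob_space_\<mu>: "prob_space (\<mu> v)"
  and sets_\<mu>: "sets (\<mu> v) = sets (restrict_space borel {0<..})"
  and no_atom: "0 < x \<Longrightarrow> emeasure (\<mu> v) {x} = 0"
  and full_support: "open U \<Longrightarrow> U \<noteq> {} \<Longrightarrow> U \<subseteq> {0<..} \<Longrightarrow> 0 < emeasure (\<mu> v) U"
  using innovations[of v] by (auto simp: innovation_law_def)

lemma space_\<mu>: "space (\<mu> v) = {0<..}"
  using sets_eq_imp_space_eq[OF sets_\<mu>] by (simp add: space_restrict_space)

sublocale product_prob_space \<mu> UNIV
  by (intro product_prob_spaceI prob_space_\<mu>)

lemma space_P: "space P = {z. \<forall>v. 0 < z v}"
  by (auto simp: space_PiM space_\<mu>)

lemma measurable_\<mu>_borel: "(\<lambda>x. x) \<in> borel_measurable (\<mu> v)"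
  by (simp add: measurable_cong_sets[OF sets_\<mu> refl] measurable_restrict_space1)

lemma measurable_coordinate [measurable]: "(\<lambda>z. z v) \<in> borel_measurable P"
  using measurable_compose[OF measurable_component_singleton[of v UNIV \<mu>] measurable_\<mu>_borel] by simp

lemma measurable_X [measurable]: "(\<lambda>z. X z i) \<in> borel_measurable P"
proof -
  have "(\<lambda>z. Max ((\<lambda>j. cs i j * z j) ` UNIV)) \<in> borel_measurable P"
    by (intro borel_measurable_Max) auto
  then show ?thesis
    by (rule measurable_cong[THEN iffD1, rotated]) (simp add: space_P max_linear_eq_Max_cs)
qed

lemma impact_graph_eq_iff:
  assumes "z \<in> space P"
  shows "impact_graph E c z = g \<longleftrightarrow> (\<forall>j i. (j, i) \<in> g \<longleftrightarrow> i \<noteq> j \<and> X z i = cs i j * z j)"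
  using assms by (auto simp: impact_graph_def space_P max_linear_eq_Max_cs set_eq_iff)

lemma impact_event_eq: "impact_event E c g = {z \<in> space P. impact_graph E c z = g}"
  by (simp add: impact_event_def space_P)

lemma sets_impact_event [measurable]: "impact_event E c g \<in> sets P"
proof -
  have [measurable]: "Measurable.pred P (\<lambda>z. X z i = cs i j * z j)" for i j
    unfolding pred_def
    by (intro borel_measurable_eq measurable_X borel_measurable_times borel_measurable_const
        measurable_coordinate)
  have "impact_event E c g =
      {z \<in> space P. \<forall>j i. (j, i) \<in> g \<longleftrightarrow> i \<noteq> j \<and> X z i = cs i j * z j}"
    unfolding impact_event_eq by (intro Collect_cong conj_cong refl impact_graph_eq_iff)
  also have "\<dots> \<in> sets P" by measurable
  finally show ?thesis .
qed

text \<open>Given the other coordinates, the event prescribes \<^term>\<open>z v\<close>, and the law of \<^term>\<open>z v\<close> has no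
  atoms.\<close>

lemma AE_not_proportional:
  assumes "v \<noteq> w"
  shows "AE z in P. z v \<noteq> t * z w"
proof -
  have U: "insert v (- {v}) = UNIV" by auto
  have "emeasure P {z \<in> space P. z v = t * z w} =
      (\<integral>\<^sup>+ z. indicator {z \<in> space P. z v = t * z w} z \<partial>PiM (insert v (- {v})) \<mu>)"
    by (simp add: U)
  also have "\<dots> = (\<integral>\<^sup>+ z. (\<integral>\<^sup>+ x. indicator {z \<in> space P. z v = t * z w} (z(v := x)) \<partial>\<mu> v) \<partial>PiM (- {v}) \<mu>)"
    by (rule product_nn_integral_insert) (auto simp: U)
  also have "\<dots> = (\<integral>\<^sup>+ z. 0 \<partial>PiM (- {v}) \<mu>)"
  proof (rule nn_integral_cong)
    fix z assume "z \<in> space (PiM (- {v}) \<mu>)"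
    have "(\<integral>\<^sup>+ x. indicator {z \<in> space P. z v = t * z w} (z(v := x)) \<partial>\<mu> v) \<le>
        (\<integral>\<^sup>+ x. indicator ({t * z w} \<inter> {0<..}) x \<partial>\<mu> v)"
      using assms by (intro nn_integral_mono) (auto simp: space_P indicator_def)
    also have "\<dots> = emeasure (\<mu> v) ({t * z w} \<inter> {0<..})"
      by (rule nn_integral_indicator) (simp add: sets_\<mu> sets_restrict_space_iff)
    also have "\<dots> = 0"
      by (cases "0 < t * z w") (auto simp: no_atom Int_insert_left)
    finally show "(\<integral>\<^sup>+ x. indicator {z \<in> space P. z v = t * z w} (z(v := x)) \<partial>\<mu> v) = 0"
      by simp
  qed
  finally have "emeasure P {z \<in> space P. z v = t * z w} = 0" by simp
  then show ?thesis by (intro AE_I[of _ _ "{z \<in> space P. z v = t * z w}"]) auto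
qed

lemma AE_generic: "AE z in P. generic z"
proof -
  have "AE z in P. \<forall>v w. \<forall>t\<in>ratios. v \<noteq> w \<longrightarrow> z v \<noteq> t * z w"
    unfolding AE_all_countable
    by (intro allI AE_finite_allI finite_ratios) (use AE_not_proportional in auto)
  moreover have "AE z in P. \<forall>v. 0 < z v"
    using AE_space[of P] by (simp add: space_P)
  ultimately show ?thesis by eventually_elim (auto simp: generic_def)
qed

text \<open>The impact graph is constant on a neighbourhood of a generic point, and neighbourhoods
  have positive probability.\<close>

lemma generic_impact_graph_realisable:
  assumes "generic z"
  shows "impact_graph E c z \<in> impact_graphs E c \<mu>"
proof -
  obtain V where "\<forall>v. open (V v) \<and> z v \<in> V v \<and> V v \<subseteq> {0<..}"
    and V4: "\<forall>z'. (\<forall>v. z' v \<in> V v) \<longrightarrow> generic z' \<and> (\<forall>i. src z' i = src z i)"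
    using generic_open[OF assms] by blast
  then have V: "open (V v)" "z v \<in> V v" "V v \<subseteq> {0<..}" for v by auto
  have sets: "V v \<in> sets (\<mu> v)" for v
    using V(1,3)[of v] by (simp add: sets_\<mu> sets_restrict_space_iff)
  have "emeasure (\<mu> v) (V v) \<noteq> 0" for v
    using full_support[OF V(1) _ V(3), of v v] V(2)[of v] by force
  then have "0 < (\<Prod>v\<in>UNIV. emeasure (\<mu> v) (V v))"
    by (simp add: zero_less_iff_neq_zero)
  also have "\<dots> = emeasure P (PiE UNIV V)"
    using sets by (simp add: emeasure_PiM)
  also have "\<dots> \<le> emeasure P (impact_event E c (impact_graph E c z))"
  proof (rule emeasure_mono)
    show "PiE UNIV V \<subseteq> impact_event E c (impact_graph E c z)"
      using V4 assms by (fastforce simp: impact_event_def impact_graph_generic PiE_UNIV_domain Pi_iff genericD)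
  qed simp
  finally show ?thesis by (simp add: impact_graphs_def)
qed

text \<open>A graph of positive probability cannot occur on the null set of non-generic points only.\<close>

lemma realisable_generic:
  assumes "g \<in> impact_graphs E c \<mu>"
  obtains z where "generic z" "impact_graph E c z = g"
proof (rule ccontr)
  assume "\<not> thesis"
  then have "AE z in P. z \<notin> impact_event E c g"
    using AE_generic that by (auto simp: impact_event_def elim!: eventually_mono)
  then have "emeasure P (impact_event E c g) = 0"
    by (subst (asm) AE_iff_measurable[OF sets_impact_event]) (auto simp: impact_event_eq)
  then show False using assms by (simp add: impact_graphs_def)
qed

section \<open>Compatible graphs and constant nodes\<close>

lemma roots_generic: "generic z \<Longrightarrow> i \<in> roots (impact_graph E c z) \<longleftrightarrow> src z i = i"
  by (auto simp: roots_def impact_graph_generic)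

lemma galaxy_map_generic:
  assumes "generic z"
  shows "galaxy_map E c (impact_graph E c z) u i = cs i (src z i) * u (src z i)"
proof (cases "src z i = i")
  case False
  then have "(THE r. (r, i) \<in> impact_graph E c z) = src z i"
    by (intro the_equality) (auto simp: impact_graph_generic[OF assms])
  then show ?thesis using False by (simp add: galaxy_map_def roots_generic[OF assms] Let_def)
qed (simp add: galaxy_map_def roots_generic[OF assms])

text \<open>Each source contributes one nonzero vector to the image, and the vectors of different
  sources have disjoint supports.\<close>

lemma context_rank_generic:
  assumes z: "generic z"
  shows "context_rank E c K (impact_graph E c z) = card (src z ` K)"
proof -
  define b :: "'v \<Rightarrow> real ^ 'v" where
    "b r = (\<chi> i. if i \<in> K \<and> src z i = r then cs i r else 0)" for r
  define f :: "real ^ 'v \<Rightarrow> real ^ 'v" where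
    "f u = (\<chi> i. if i \<in> K then galaxy_map E c (impact_graph E c z) (($) u) i else 0)" for u
  have f_sum: "f u = (\<Sum>r\<in>src z ` K. (u $ r) *\<^sub>R b r)" for u
    by (auto simp: f_def b_def vec_eq_iff galaxy_map_generic[OF z] if_distrib sum.delta
        cong: if_cong)
  have b_nz: "b (src z k) \<noteq> 0" if "k \<in> K" for k
    using that cs_src_pos[OF z, of k] by (auto simp: b_def vec_eq_iff intro!: exI[of _ k])
  have orth: "b r \<bullet> b r' = 0" if "r \<noteq> r'" for r r'
    using that by (auto simp: b_def inner_vec_def intro!: sum.neutral)
  have inj: "inj_on b (src z ` K)"
  proof (rule inj_onI, rule ccontr)
    fix r r' assume "r \<in> src z ` K" "r' \<in> src z ` K" "b r = b r'" "r \<noteq> r'"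
    then show False using orth[of r r'] b_nz by auto
  qed
  have "independent (b ` src z ` K)"
    using b_nz
    by (intro pairwise_orthogonal_independent) (auto simp: pairwise_def orthogonal_def intro!: orth)
  moreover have "b r \<in> range f" if "r \<in> src z ` K" for r
  proof
    show "b r = f (axis r 1)"
      using that by (simp add: f_sum axis_def if_distrib[of "\<lambda>x. x *\<^sub>R _"] sum.delta cong: if_cong)
  qed simp
  moreover have "f u \<in> span (b ` src z ` K)" for u
    unfolding f_sum by (intro span_sum span_scale span_base imageI)
  then have "range f \<subseteq> span (b ` src z ` K)" by blast
  ultimately have "card (b ` src z ` K) = dim (range f)"
    using basis_card_eq_dim[of "b ` src z ` K" "range f"] by auto
  then show ?thesis
    using inj by (simp add: context_rank_def f_def[abs_def] card_image)
qed

text \<open>Two nodes with a common source in one graph have proportional values on the whole event of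
  that graph, also at its non-generic points such as \<^term>\<open>u\<close>. At a generic point, values with
  different sources are never proportional in this way.\<close>

lemma common_source_transfer:
  assumes z: "generic z" and w: "generic w"
    and u: "u \<in> impact_event E c (impact_graph E c w)"
    and eq: "X u k = X z k" "X u k' = X z k'"
    and "src w k = src w k'"
  shows "src z k = src z k'"
proof (rule ccontr)
  assume ne: "src z k \<noteq> src z k'"
  have pos: "\<And>v. 0 < u v" and g: "impact_graph E c u = impact_graph E c w"
    using u by (auto simp: impact_event_def)
  have X_u: "X u i = cs i (src w i) * u (src w i)" for i
  proof (cases "src w i = i")
    case True
    obtain j where j: "X u i = cs i j * u j" "0 < cs i j" by (rule X_attained[OF pos])
    have "(j, i) \<notin> impact_graph E c u" using True by (auto simp: g impact_graph_generic[OF w])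
    then have "j = i" using j by (auto simp: impact_graph_def max_linear_eq_Max_cs[OF pos])
    then show ?thesis using j True by simp
  next
    case False
    then have "(src w i, i) \<in> impact_graph E c u" by (simp add: g impact_graph_generic[OF w])
    then show ?thesis by (simp add: impact_graph_def max_linear_eq_Max_cs[OF pos])
  qed
  let ?s = "src w k"
  have "X z k / cs k ?s = u ?s" "X z k' / cs k' ?s = u ?s"
    using X_u[of k] X_u[of k'] eq cs_src_pos[OF w, of k] cs_src_pos[OF w, of k'] assms(6)
    by (simp_all add: field_simps)
  then show False
    using generic_cross_tie[OF z ne, of k ?s k'] cs_src_pos[OF z, of k] cs_src_pos[OF w, of k]
      cs_src_pos[OF w, of k'] assms(6) by (simp add: X_src[OF z])
qed

text \<open>A graph consistent with the values of \<^term>\<open>z\<close> on \<^term>\<open>K\<close> separates all nodes of \<^term>\<open>K\<close> that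
  have different sources at \<^term>\<open>z\<close>. Hence it has at least as many sources, and the graph at \<^term>\<open>z\<close>
  has minimal rank.\<close>

lemma generic_compatible:
  assumes z: "generic z" and x: "\<And>k. k \<in> K \<Longrightarrow> X z k = x k"
  shows "impact_graph E c z \<in> compatible_graphs E c \<mu> K x"
proof -
  have "z \<in> impact_event E c (impact_graph E c z) \<inter> context_event E c K x"
    using genericD[OF z] x by (simp add: impact_event_def context_event_def)
  then have "impact_graph E c z \<in> consistent_graphs E c \<mu> K x"
    using generic_impact_graph_realisable[OF z] by (auto simp: consistent_graphs_def)
  moreover have "context_rank E c K (impact_graph E c z) \<le> context_rank E c K g"
    if consistent: "g \<in> consistent_graphs E c \<mu> K x" for g
  proof -
    obtain u where u: "u \<in> impact_event E c g" "u \<in> context_event E c K x"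
      and g: "g \<in> impact_graphs E c \<mu>"
      using consistent unfolding consistent_graphs_def by blast
    obtain w where w: "generic w" "impact_graph E c w = g" using realisable_generic[OF g] by blast
    have coarser: "src z k = src z k'" if "k \<in> K" "k' \<in> K" "src w k = src w k'" for k k'
      by (rule common_source_transfer[OF z w(1)]) (use u w that x in \<open>auto simp: context_event_def\<close>)
    define h where "h s = src z (SOME k. k \<in> K \<and> src w k = s)" for s
    have "src z k = h (src w k)" if "k \<in> K" for k
      unfolding h_def by (rule someI2[of _ k]) (use that in \<open>auto intro: coarser\<close>)
    then have "src z ` K = h ` src w ` K" unfolding image_image by (rule image_cong[OF refl])
    then have "card (src z ` K) \<le> card (src w ` K)" by (simp add: card_image_le)
    then show ?thesis using w context_rank_generic[OF z] context_rank_generic[OF w(1)] by simp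
  qed
  ultimately show ?thesis by (simp add: compatible_graphs_def)
qed

definition fibre :: "'v set \<Rightarrow> ('v \<Rightarrow> real) \<Rightarrow> ('v \<Rightarrow> real) set" where
  "fibre K x = {z. generic z \<and> (\<forall>k\<in>K. X z k = x k)}"

lemma fibreD:
  assumes "z \<in> fibre K x"
  shows "generic z" "k \<in> K \<Longrightarrow> X z k = x k" "0 < z v"
    "impact_graph E c z \<in> compatible_graphs E c \<mu> K x"
  using assms genericD generic_compatible by (auto simp: fibre_def)

lemma fibre_same_partition:
  assumes "z \<in> fibre K x" "w \<in> fibre K x" "k \<in> K" "k' \<in> K" "src w k = src w k'"
  shows "src z k = src z k'"
  by (rule common_source_transfer[of z w w]) (use assms in \<open>auto simp: fibre_def impact_event_def genericD\<close>)

text \<open>Each point of the fibre makes the context possible that is extended by its own value at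
  \<^term>\<open>j\<close>.\<close>

lemma constant_node_on_fibre:
  assumes "j \<in> constant_nodes E c \<mu> K x" "z \<in> fibre K x" "w \<in> fibre K x"
  shows "X z j = X w j"
proof -
  obtain y where y: "\<And>x'. (\<forall>k\<in>K. x' k = x k) \<Longrightarrow>
      possible_context E c \<mu> (insert j K) x' \<longleftrightarrow> x' j = y"
    using assms(1) by (auto simp: constant_nodes_def)
  have "X u j = y" if "u \<in> fibre K x" for u
    using y[of "X u"] generic_compatible[of u "insert j K" "X u"] that
    by (auto simp: fibre_def possible_context_def)
  then show ?thesis using assms by simp
qed

lemma conditioned_constant:
  assumes "z \<in> fibre K x"
  shows "K \<subseteq> constant_nodes E c \<mu> K x"
proof
  fix j assume j: "j \<in> K"
  have "possible_context E c \<mu> (insert j K) x' \<longleftrightarrow> x' j = x j" if "\<forall>k\<in>K. x' k = x k" for x'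
    using that j assms generic_compatible[of z K x']
    by (auto simp: insert_absorb fibre_def possible_context_def)
  moreover have "0 < x j" using X_pos[of z j] assms j by (auto simp: fibre_def genericD)
  ultimately show "j \<in> constant_nodes E c \<mu> K x" unfolding constant_nodes_def by blast
qed

text \<open>A source that feeds no node of \<^term>\<open>K\<close> can be moved a little without changing the graph or
  the context, so the graph is compatible with two different values at \<^term>\<open>j\<close>. Minimality of its
  rank in the extended contexts is again \<open>generic_compatible\<close>.\<close>

lemma free_source_not_constant_under:
  assumes z: "z \<in> fibre K x" and j: "src z j = j" and free: "\<And>k. k \<in> K \<Longrightarrow> src z k \<noteq> j"
  shows "j \<notin> constant_nodes_under E c \<mu> K x (impact_graph E c z)"
proof
  assume "j \<in> constant_nodes_under E c \<mu> K x (impact_graph E c z)"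
  then obtain y where y: "\<And>x'. (\<forall>k\<in>K. x' k = x k) \<Longrightarrow>
      impact_graph E c z \<in> compatible_graphs E c \<mu> (insert j K) x' \<longleftrightarrow> x' j = y"
    by (auto simp: constant_nodes_under_def)
  have y_eq: "X u j = y" if "u \<in> fibre K x" "impact_graph E c u = impact_graph E c z" for u
    using y[of "X u"] generic_compatible[of u "insert j K" "X u"] that by (auto simp: fibre_def)
  obtain V where "\<forall>v. open (V v) \<and> z v \<in> V v \<and> V v \<subseteq> {0<..}"
    and V: "\<forall>z'. (\<forall>v. z' v \<in> V v) \<longrightarrow> generic z' \<and> (\<forall>i. src z' i = src z i)"
    using generic_open[OF fibreD(1)[OF z]] by blast
  then have zV: "open (V v)" "z v \<in> V v" for v by auto
  have "V j \<noteq> {z j}" using zV(1)[of j] not_open_singleton[of "z j"] by auto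
  then obtain t where t: "t \<in> V j" "t \<noteq> z j" using zV(2)[of j] by blast
  let ?u = "z(j := t)"
  have "\<forall>v. ?u v \<in> V v" using t zV(2) by simp
  then have "generic ?u \<and> (\<forall>i. src ?u i = src z i)" by (rule V[THEN spec, THEN mp])
  then have u: "generic ?u" "src ?u i = src z i" for i by auto
  have "X ?u k = X z k" if "k \<in> K" for k
    using free[OF that] u fibreD(1)[OF z] by (simp add: X_src)
  then have "?u \<in> fibre K x" using u z by (auto simp: fibre_def)
  moreover have "impact_graph E c ?u = impact_graph E c z"
    using u fibreD(1)[OF z] by (simp add: impact_graph_generic)
  ultimately have "X ?u j = X z j" using y_eq z by simp
  then show False using X_of_source[OF u(1)] X_of_source[OF fibreD(1)[OF z]] u(2) j t by simp
qed

section \<open>The source DAG and the noise a node depends on\<close>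

text \<open>The nodes whose innovations \<^term>\<open>X z i\<close> depends on within the fibre, see \<open>X_on_fibre\<close>.\<close>

definition carriers :: "'v set \<Rightarrow> ('v \<Rightarrow> real) \<Rightarrow> 'v \<Rightarrow> 'v set" where
  "carriers K x i =
     (if i \<in> constant_nodes E c \<mu> K x then {}
      else {j. j \<notin> constant_nodes E c \<mu> K x \<and> (j = i \<or> (j, i) \<in> source_dag E c \<mu> K x)})"

definition least_value :: "'v set \<Rightarrow> ('v \<Rightarrow> real) \<Rightarrow> 'v \<Rightarrow> real" where
  "least_value K x i = (INF z\<in>fibre K x. X z i)"

lemma least_value_le: "z \<in> fibre K x \<Longrightarrow> least_value K x i \<le> X z i"
  unfolding least_value_def
  by (intro cINF_lower bdd_belowI2[of _ 0]) (auto intro: less_imp_le X_pos dest: fibreD)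

lemma X_edge_mono:
  assumes "\<And>v. 0 < z v"
  shows "cs i j * X z j \<le> X z i"
proof -
  obtain l where l: "X z j = cs j l * z l" "0 < cs j l" by (rule X_attained[OF assms])
  have "cs i j * X z j = (cs i j * cs j l) * z l" by (simp add: l)
  also have "\<dots> \<le> cs i l * z l"
    using assms by (intro mult_right_mono cs_trans less_imp_le)
  also have "\<dots> \<le> X z i" by (rule X_ge[OF assms])
  finally show ?thesis .
qed

text \<open>For \<^term>\<open>K = {}\<close> the source DAG is the reachability DAG, which contains the edges of all impact
  graphs.\<close>

lemma source_dagI:
  assumes z: "z \<in> fibre K x" and "src z i = j" "j \<noteq> i" "\<not> redundant_edge E c \<mu> K x j i"
  shows "(j, i) \<in> source_dag E c \<mu> K x"
proof -
  have "(j, i) \<in> impact_graph E c z"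
    using assms(2,3) impact_graph_generic[OF fibreD(1)[OF z]] by simp
  then have "(j, i) \<in> context_impact_graph E c \<mu> K x"
    unfolding context_impact_graph_def using fibreD(4)[OF z] by blast
  then show ?thesis
    using assms cs_src_pos[OF fibreD(1)[OF z], of i] by (auto simp: source_dag_def)
qed

text \<open>If every compatible graph that sends \<^term>\<open>j\<close> to \<^term>\<open>i\<close> fixes \<^term>\<open>j\<close> by the context, the
  value that \<^term>\<open>i\<close> receives from \<^term>\<open>j\<close> is the least possible one: at a point of the fibre with
  a smaller value at \<^term>\<open>i\<close>, the innovation at \<^term>\<open>j\<close> could be raised to just below the bound that
  the context imposes, which makes \<^term>\<open>j\<close> a free source of \<^term>\<open>i\<close>.\<close>

lemma fixed_source_least:
  assumes z: "z \<in> fibre K x" and src: "src z i = j"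
    and fixed: "\<And>g. g \<in> compatible_graphs E c \<mu> K x \<Longrightarrow> (j, i) \<in> g \<Longrightarrow>
      j \<in> constant_nodes_under E c \<mu> K x g"
    and j: "j \<noteq> i" and w: "w \<in> fibre K x"
  shows "X z i \<le> X w i"
proof (rule ccontr)
  assume "\<not> X z i \<le> X w i"
  then have less: "X w i < cs i j * z j" using X_src[OF fibreD(1)[OF z], of i] src by simp
  have cij: "0 < cs i j" using cs_src_pos[OF fibreD(1)[OF z], of i] src by simp
  have sj: "src z j = j" using src_src[OF fibreD(1)[OF z], of i] src by simp
  have "j \<in> constant_nodes_under E c \<mu> K x (impact_graph E c z)"
    using src j by (intro fixed fibreD(4)[OF z]) (simp add: impact_graph_generic[OF fibreD(1)[OF z]])
  then have "\<exists>k\<in>K. src z k = j"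
    using free_source_not_constant_under[OF z sj] by blast
  then have z_le: "cs k j * z j \<le> x k" if "k \<in> K" for k
    using X_ge[of z k j] fibreD[OF z] that by auto
  have "cs i j * w j \<le> X w i" by (intro X_ge fibreD(3)[OF w])
  then have wj: "w j \<le> X w i / cs i j" "X w i / cs i j < z j"
    using less cij by (simp_all add: field_simps)
  \<comment> \<open>the lower bound makes \<open>j\<close> the source of \<open>i\<close>, the upper one leaves the values on \<open>K\<close> alone\<close>
  obtain t where t: "X w i / cs i j < t" "t < z j" and gen: "generic (w(j := t))"
    using generic_update_between[OF fibreD(1)[OF w], of "X w i / cs i j" "z j" j]
      wj(2) less_imp_le[OF X_pos[of w i]] less_imp_le[OF cij] fibreD(3)[OF w] by auto
  let ?u = "w(j := t)"
  have pos: "0 < ?u v" for v by (rule genericD[OF gen])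
  have src_K: "src w k \<noteq> j" if "k \<in> K" for k
  proof
    assume s: "src w k = j"
    have "w j < z j" using wj by simp
    then have "cs k j * w j < cs k j * z j" using cs_src_pos[OF fibreD(1)[OF w], of k] s by simp
    then show False
      using z_le[OF that] X_src[OF fibreD(1)[OF w], of k] s fibreD(2)[OF w that] by simp
  qed
  have X_K: "X ?u k = cs k (src w k) * ?u (src w k)" if k: "k \<in> K" for k
  proof (rule X_eqI[OF pos])
    fix v
    have "cs k (src w k) * ?u (src w k) = x k"
      using src_K[OF k] X_src[OF fibreD(1)[OF w], of k] fibreD(2)[OF w k] by simp
    moreover have "cs k v * ?u v \<le> x k"
    proof (cases "v = j")
      case True
      have "cs k j * t \<le> cs k j * z j" using t cs_nonneg by (simp add: mult_left_mono)
      then show ?thesis using True z_le[OF k] by simp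
    next
      case False
      then show ?thesis using X_ge[of w k v] fibreD(2,3)[OF w] k by auto
    qed
    ultimately show "cs k v * ?u v \<le> cs k (src w k) * ?u (src w k)" by simp
  qed
  have "X ?u k = x k" if "k \<in> K" for k
    using X_K[OF that] src_K[OF that] X_src[OF fibreD(1)[OF w], of k] fibreD(2)[OF w that] by simp
  then have u: "?u \<in> fibre K x" using gen by (simp add: fibre_def)
  have free: "src ?u k \<noteq> j" if "k \<in> K" for k
    using src_eqI[OF gen X_K[OF that]] src_K[OF that] by simp
  have "X ?u i = cs i j * ?u j"
  proof (rule X_eqI[OF pos])
    fix v
    have "X w i \<le> cs i j * t" using t(1) cij by (simp add: field_simps)
    then show "cs i v * ?u v \<le> cs i j * ?u j"
      using X_ge[of w i v] fibreD(3)[OF w] by auto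
  qed
  then have si: "src ?u i = j" by (rule src_eqI[OF gen])
  then have "(j, i) \<in> impact_graph E c ?u" using j by (simp add: impact_graph_generic[OF gen])
  then have "j \<in> constant_nodes_under E c \<mu> K x (impact_graph E c ?u)"
    by (intro fixed fibreD(4)[OF u])
  moreover have "src ?u j = j" using src_src[OF gen, of i] si by simp
  ultimately show False using free_source_not_constant_under[OF u] free by blast
qed

text \<open>If the source \<open>j\<close> of \<^term>\<open>i\<close> is not among the carriers, then \<^term>\<open>X z i\<close> takes its least value:
  either \<open>j\<close> is constant and contributes the same amount everywhere, or its edge to \<^term>\<open>i\<close> is
  redundant and \<open>fixed_source_least\<close> applies.\<close>

lemma X_on_fibre:
  assumes z: "z \<in> fibre K x"
  shows "X z i = Max (insert (least_value K x i) ((\<lambda>j. cs i j * z j) ` carriers K x i))"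
    (is "_ = Max ?A")
proof (rule Max_eqI[symmetric])
  fix y assume "y \<in> ?A"
  then show "y \<le> X z i" using least_value_le[OF z] X_ge fibreD(3)[OF z] by auto
next
  let ?j = "src z i"
  have gen: "generic z" by (rule fibreD(1)[OF z])
  have least: "X z i \<in> ?A" if "\<And>w. w \<in> fibre K x \<Longrightarrow> X z i \<le> X w i"
  proof -
    have "X z i \<le> least_value K x i"
      unfolding least_value_def using z that by (intro cINF_greatest) auto
    then show ?thesis using least_value_le[OF z, of i] by simp
  qed
  consider "i \<in> constant_nodes E c \<mu> K x" | "?j \<in> carriers K x i"
    | "i \<notin> constant_nodes E c \<mu> K x" "?j \<in> constant_nodes E c \<mu> K x"
    | "i \<notin> constant_nodes E c \<mu> K x" "?j \<notin> constant_nodes E c \<mu> K x"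
      "?j \<noteq> i" "(?j, i) \<notin> source_dag E c \<mu> K x"
    by (cases "i \<in> constant_nodes E c \<mu> K x") (auto simp: carriers_def)
  then show "X z i \<in> ?A"
  proof cases
    case 1
    then show ?thesis using constant_node_on_fibre[OF _ z] by (intro least) fastforce
  next
    case 2
    then show ?thesis using X_src[OF gen, of i] by auto
  next
    case 3
    show ?thesis
    proof (rule least)
      fix w assume w: "w \<in> fibre K x"
      have "X z i = cs i ?j * X z ?j"
        using X_src[OF gen] X_of_source[OF gen src_src[OF gen]] by simp
      also have "\<dots> = cs i ?j * X w ?j" using constant_node_on_fibre[OF 3(2) z w] by simp
      also have "\<dots> \<le> X w i" by (rule X_edge_mono[OF fibreD(3)[OF w]])
      finally show "X z i \<le> X w i" .
    qed
  next
    case 4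
    then have "redundant_edge E c \<mu> K x ?j i" using source_dagI[OF z refl] by blast
    then show ?thesis
      using 4 by (intro least fixed_source_least[OF z refl]) (auto simp: redundant_edge_def)
  qed
qed simp

text \<open>Sources of nodes in \<^term>\<open>K\<close> are never redundant unless they are constant, since
  \<^term>\<open>K\<close> consists of constant nodes.\<close>

lemma source_dag_into_context:
  assumes z: "z \<in> fibre K x" and "k \<in> K" "src z k \<notin> constant_nodes E c \<mu> K x"
  shows "(src z k, k) \<in> source_dag E c \<mu> K x"
  using assms conditioned_constant[OF z]
  by (intro source_dagI[OF z refl]) (auto simp: redundant_edge_def)

lemma star_connected_if_shared_carrier:
  assumes "j \<in> carriers K x i" "j \<in> carriers K x i'" "z \<in> fibre K x"
    and "i \<notin> K" "i' \<notin> K" "i \<noteq> i'"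
  shows "star_connected (source_dag E c \<mu> K x) K i i'"
proof -
  have "j \<notin> K" using assms conditioned_constant by (auto simp: carriers_def split: if_splits)
  then show ?thesis
    using assms unfolding star_connected_def star_path_form_def carriers_def
    by (auto split: if_splits)
qed

text \<open>Two alternative sources of \<^term>\<open>k\<close> give a path of the form (c), (d) or (e), according to whether
  they are the nodes \<^term>\<open>i\<close> and \<^term>\<open>i'\<close> themselves. When a source of one node is the other node,
  the path degenerates to form (a).\<close>

lemma star_connected_if_common_target:
  assumes "src z k \<in> carriers K x i" "src w k \<in> carriers K x i'"
    and z: "z \<in> fibre K x" and w: "w \<in> fibre K x" and k: "k \<in> K"
    and i: "i \<notin> K" "i' \<notin> K" "i \<noteq> i'"
  shows "star_connected (source_dag E c \<mu> K x) K i i'"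
proof (cases "src z k = src w k")
  case True
  then show ?thesis using star_connected_if_shared_carrier assms by metis
next
  case False
  let ?G = "source_dag E c \<mu> K x" and ?j = "src z k" and ?j' = "src w k"
  have nc: "?j \<notin> constant_nodes E c \<mu> K x" "?j' \<notin> constant_nodes E c \<mu> K x"
    using assms(1,2) by (auto simp: carriers_def split: if_splits)
  then have K: "?j \<notin> K" "?j' \<notin> K" using conditioned_constant[OF z] by auto
  have into: "(?j, k) \<in> ?G" "(?j', k) \<in> ?G"
    using source_dag_into_context[OF z k] source_dag_into_context[OF w k] nc by auto
  have edge: "?j = i \<or> (?j, i) \<in> ?G" "?j' = i' \<or> (?j', i') \<in> ?G"
    using assms(1,2) by (auto simp: carriers_def split: if_splits)
  consider "?j = i" "?j' = i'" | "?j = i" "?j' \<noteq> i'" | "?j \<noteq> i" "?j' = i'"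
    | "?j = i'" "?j \<noteq> i" | "?j' = i" "?j' \<noteq> i'" | "distinct [i, i', ?j', ?j]"
    using False i by auto
  then show ?thesis
  proof cases
    case 1
    then have "star_path_form ?G K i i'"
      unfolding star_path_form_def using i k into by metis
    then show ?thesis by (simp add: star_connected_def)
  next
    case 2
    then have "distinct [i, i', ?j']" using False i by auto
    then have "star_path_form ?G K i i'"
      unfolding star_path_form_def using i k into edge K 2 by metis
    then show ?thesis by (simp add: star_connected_def)
  next
    case 3
    then have "distinct [i', i, ?j]" using False i by auto
    then have "star_path_form ?G K i' i"
      unfolding star_path_form_def using i k into edge K 3 by metis
    then show ?thesis by (simp add: star_connected_def)
  next
    case 4
    then show ?thesis using i edge by (simp add: star_connected_def star_path_form_def)
  next
    case 5
    then show ?thesis using i edge by (simp add: star_connected_def star_path_form_def)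
  next
    case 6
    then have "(?j, i) \<in> ?G" "(?j', i') \<in> ?G" using edge by auto
    then have "star_path_form ?G K i i'"
      unfolding star_path_form_def using i k into K 6 by metis
    then show ?thesis by (simp add: star_connected_def)
  qed
qed

text \<open>The group \<open>U\<close> consists of the carriers of \<^term>\<open>I\<close> and of all alternative sources of those
  nodes of \<^term>\<open>K\<close> that have such a carrier as a source somewhere on the fibre. This is already
  closed under passing to alternative sources: a node that is a source of both \<open>k\<close> and \<open>k'\<close>, even at
  different points of the fibre, puts them into the same block, and the blocks are the same
  throughout the fibre.\<close>

lemma separating_split:
  assumes sep: "\<And>i j. i \<in> I \<Longrightarrow> j \<in> J \<Longrightarrow> \<not> star_connected (source_dag E c \<mu> K x) K i j"
    and disj: "I \<inter> J = {}" "I \<inter> K = {}" "J \<inter> K = {}" and ne: "fibre K x \<noteq> {}"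
  shows "\<exists>U L. L \<subseteq> K \<and> (\<forall>i\<in>I. carriers K x i \<subseteq> U) \<and> (\<forall>j\<in>J. carriers K x j \<subseteq> - U) \<and>
    (\<forall>z\<in>fibre K x. \<forall>k\<in>K. src z k \<in> U \<longleftrightarrow> k \<in> L)"
proof -
  define S where "S = (\<Union>i\<in>I. carriers K x i)"
  define L where "L = {k \<in> K. \<exists>z\<in>fibre K x. src z k \<in> S}"
  define U where "U = S \<union> {src z k | z k. z \<in> fibre K x \<and> k \<in> L}"
  have src_U: "src z k \<in> U \<longleftrightarrow> k \<in> L" if z: "z \<in> fibre K x" and k: "k \<in> K" for z k
  proof
    assume "src z k \<in> U"
    then consider "src z k \<in> S"
      | w k' where "src z k = src w k'" "w \<in> fibre K x" "k' \<in> L"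
      by (auto simp: U_def)
    then show "k \<in> L"
    proof cases
      case 1
      then show ?thesis using z k by (auto simp: L_def)
    next
      case 2
      let ?j = "src w k'"
      have k': "k' \<in> K" using 2 by (simp add: L_def)
      note gz = fibreD(1)[OF z] and gw = fibreD(1)[OF 2(2)]
      \<comment> \<open>both points put the innovation at the common source on the bound given by the context\<close>
      have "cs k' ?j * z ?j \<le> cs k' ?j * w ?j"
        using X_ge[of z k' ?j] fibreD(2,3)[OF z] fibreD(2)[OF 2(2) k'] X_src[OF gw, of k'] k' by auto
      then have le: "z ?j \<le> w ?j" using cs_src_pos[OF gw, of k'] by simp
      have "cs k ?j * w ?j \<le> cs k ?j * z ?j"
        using X_ge[of w k ?j] fibreD(2,3)[OF 2(2)] fibreD(2)[OF z k] X_src[OF gz, of k] 2(1) k by auto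
      then have "w ?j \<le> z ?j" using cs_src_pos[OF gz, of k] 2(1) by simp
      then have "X z k' = cs k' ?j * z ?j"
        using le X_src[OF gw, of k'] fibreD(2)[OF 2(2) k'] fibreD(2)[OF z k'] by simp
      then have "src z k' = src z k" using src_eqI[OF gz] 2(1) by simp
      moreover obtain u where "u \<in> fibre K x" "src u k' \<in> S" using 2 by (auto simp: L_def)
      ultimately show ?thesis using fibre_same_partition[of u K x z k' k] k k' z by (auto simp: L_def)
    qed
  qed (use z in \<open>auto simp: U_def\<close>)
  have J_U: "carriers K x j \<inter> U = {}" if j: "j \<in> J" for j
  proof (rule ccontr)
    assume "carriers K x j \<inter> U \<noteq> {}"
    then obtain v where v: "v \<in> carriers K x j" "v \<in> U" by blast
    obtain z where z: "z \<in> fibre K x" using ne by blast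
    consider i where "i \<in> I" "v \<in> carriers K x i"
      | w k u i where "w \<in> fibre K x" "u \<in> fibre K x" "k \<in> K" "v = src w k"
        "i \<in> I" "src u k \<in> carriers K x i"
      using v(2) by (auto simp: U_def S_def L_def)
    then show False
    proof cases
      case 1
      then show False
        using star_connected_if_shared_carrier[OF 1(2) v(1) z] sep[OF 1(1) j] disj j by auto
    next
      case 2
      then show False
        using star_connected_if_common_target[of u k K x i w j] v(1) sep[OF 2(5) j] disj j by auto
    qed
  qed
  have "L \<subseteq> K" by (auto simp: L_def)
  moreover have "carriers K x i \<subseteq> U" if "i \<in> I" for i using that by (auto simp: U_def S_def)
  moreover have "carriers K x j \<subseteq> - U" if "j \<in> J" for j using J_U[OF that] by blast
  ultimately show ?thesis using src_U by (intro exI[of _ U] exI[of _ L]) simp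
qed

end

section \<open>Conditioning two independent families on cross-dependent events\<close>

locale independent_pair =
  A: prob_space A + B: prob_space B
  for A :: "'a measure" and B :: "'b measure" +
  fixes MY :: "'y measure" and MY' :: "'z measure" and \<phi> :: "'a \<Rightarrow> 'y" and \<phi>' :: "'b \<Rightarrow> 'z"
  assumes \<phi> [measurable]: "\<phi> \<in> measurable A MY" and \<phi>' [measurable]: "\<phi>' \<in> measurable B MY'"
begin

sublocale AB: pair_prob_space A B ..

definition Y :: "'a \<times> 'b \<Rightarrow> 'y \<times> 'z" where
  "Y p = (\<phi> (fst p), \<phi>' (snd p))"

definition law :: "('y \<times> 'z) measure" where
  "law = distr (A \<Otimes>\<^sub>M B) (MY \<Otimes>\<^sub>M MY') Y"

text \<open>The conditional expectation of \<^term>\<open>f\<close> given \<^term>\<open>Y\<close>, as a function of the value of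
  \<^term>\<open>Y\<close>.\<close>

definition cond :: "('a \<times> 'b \<Rightarrow> ennreal) \<Rightarrow> 'y \<times> 'z \<Rightarrow> ennreal" where
  "cond f = RN_deriv law (distr (density (A \<Otimes>\<^sub>M B) f) (MY \<Otimes>\<^sub>M MY') Y)"

lemma measurable_Y [measurable]: "Y \<in> measurable (A \<Otimes>\<^sub>M B) (MY \<Otimes>\<^sub>M MY')"
  unfolding Y_def by measurable

lemma prob_space_law: "prob_space law"
  unfolding law_def by (rule AB.prob_space_distr) simp

lemma sets_law [measurable_cong]: "sets law = sets (MY \<Otimes>\<^sub>M MY')"
  by (simp add: law_def)

lemma measurable_cond [measurable]: "cond f \<in> borel_measurable (MY \<Otimes>\<^sub>M MY')"
proof -
  have "cond f \<in> borel_measurable law" unfolding cond_def by (rule borel_measurable_RN_deriv)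
  then show ?thesis by (simp add: measurable_cong_sets[OF sets_law refl])
qed

lemma nn_integral_cond:
  assumes f [measurable]: "f \<in> borel_measurable (A \<Otimes>\<^sub>M B)"
    and g [measurable]: "g \<in> borel_measurable (MY \<Otimes>\<^sub>M MY')"
  shows "(\<integral>\<^sup>+ p. g (Y p) * f p \<partial>(A \<Otimes>\<^sub>M B)) = (\<integral>\<^sup>+ y. g y * cond f y \<partial>law)"
proof -
  interpret law: prob_space law by (rule prob_space_law)
  let ?D = "distr (density (A \<Otimes>\<^sub>M B) f) (MY \<Otimes>\<^sub>M MY') Y"
  have ac: "absolutely_continuous law ?D"
    unfolding absolutely_continuous_def
  proof
    fix N assume N: "N \<in> null_sets law"
    then have [measurable]: "N \<in> sets (MY \<Otimes>\<^sub>M MY')"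
      using sets_law by auto
    have "emeasure (A \<Otimes>\<^sub>M B) (Y -` N \<inter> space (A \<Otimes>\<^sub>M B)) = 0"
      using N by (simp add: law_def null_sets_def emeasure_distr)
    then have "AE p in A \<Otimes>\<^sub>M B. p \<notin> Y -` N \<inter> space (A \<Otimes>\<^sub>M B)"
      by (intro AE_not_in null_setsI) auto
    then have "(\<integral>\<^sup>+ p. f p * indicator (Y -` N \<inter> space (A \<Otimes>\<^sub>M B)) p \<partial>(A \<Otimes>\<^sub>M B)) = 0"
      by (subst nn_integral_0_iff_AE) (auto elim!: eventually_mono)
    then show "N \<in> null_sets ?D"
      by (auto intro!: null_setsI simp: emeasure_distr emeasure_density)
  qed
  have "(\<integral>\<^sup>+ p. g (Y p) * f p \<partial>(A \<Otimes>\<^sub>M B)) = (\<integral>\<^sup>+ y. g y \<partial>?D)"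
    by (simp add: nn_integral_distr nn_integral_density mult.commute)
  also have "\<dots> = (\<integral>\<^sup>+ y. cond f y * g y \<partial>law)"
    unfolding cond_def by (rule law.RN_deriv_nn_integral[OF ac]) (simp_all add: sets_law)
  finally show ?thesis by (simp add: mult.commute)
qed

lemma nn_integral_law:
  "g \<in> borel_measurable (MY \<Otimes>\<^sub>M MY') \<Longrightarrow> (\<integral>\<^sup>+ y. g y \<partial>law) = (\<integral>\<^sup>+ p. g (Y p) \<partial>(A \<Otimes>\<^sub>M B))"
  by (simp add: law_def nn_integral_distr)

text \<open>Given \<^term>\<open>Y\<close>, a variable built from the second family and \<^term>\<open>\<phi>\<close> does not depend on the
  rest of the first family. On products this is Fubini: the inner integral over the second family
  is a function of \<^term>\<open>\<phi>\<close> alone, and it is determined almost everywhere by its integrals over the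
  events of \<^term>\<open>\<phi>\<close>.\<close>

lemma nn_integral_cond_snd_rect:
  fixes h' :: "'b \<times> 'y \<Rightarrow> ennreal"
  assumes h' [measurable]: "h' \<in> borel_measurable (B \<Otimes>\<^sub>M MY)" and le: "\<And>p. h' p \<le> 1"
    and S [measurable]: "S \<in> sets A" and C [measurable]: "C \<in> sets MY'"
  defines "f \<equiv> \<lambda>p. h' (snd p, \<phi> (fst p))"
  shows "(\<integral>\<^sup>+ p. indicator S (fst p) * indicator C (\<phi>' (snd p)) * f p \<partial>(A \<Otimes>\<^sub>M B)) =
    (\<integral>\<^sup>+ p. indicator S (fst p) * indicator C (\<phi>' (snd p)) * cond f (Y p) \<partial>(A \<Otimes>\<^sub>M B))"
proof -
  have f [measurable]: "f \<in> borel_measurable (A \<Otimes>\<^sub>M B)" unfolding f_def by measurable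
  define H1 where "H1 y = (\<integral>\<^sup>+ b. indicator C (\<phi>' b) * h' (b, y) \<partial>B)" for y
  define H2 where "H2 y = (\<integral>\<^sup>+ b. indicator C (\<phi>' b) * cond f (y, \<phi>' b) \<partial>B)" for y
  have [measurable]: "H1 \<in> borel_measurable MY" "H2 \<in> borel_measurable MY"
    unfolding H1_def H2_def by measurable
  have fub1: "(\<integral>\<^sup>+ p. g (fst p) * indicator C (\<phi>' (snd p)) * f p \<partial>(A \<Otimes>\<^sub>M B)) =
      (\<integral>\<^sup>+ a. g a * H1 (\<phi> a) \<partial>A)" if [measurable]: "g \<in> borel_measurable A" for g
    by (subst B.nn_integral_fst[symmetric])
       (auto simp: H1_def f_def mult.assoc nn_integral_cmult intro!: nn_integral_cong)
  have fub2: "(\<integral>\<^sup>+ p. g (fst p) * indicator C (\<phi>' (snd p)) * cond f (Y p) \<partial>(A \<Otimes>\<^sub>M B)) =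
      (\<integral>\<^sup>+ a. g a * H2 (\<phi> a) \<partial>A)" if [measurable]: "g \<in> borel_measurable A" for g
    by (subst B.nn_integral_fst[symmetric])
       (auto simp: H2_def Y_def mult.assoc nn_integral_cmult intro!: nn_integral_cong)
  let ?L = "distr A MY \<phi>"
  interpret L: prob_space ?L by (rule A.prob_space_distr) simp
  have int: "(\<integral>\<^sup>+ a. indicator G (\<phi> a) * H1 (\<phi> a) \<partial>A) = (\<integral>\<^sup>+ a. indicator G (\<phi> a) * H2 (\<phi> a) \<partial>A)"
    if [measurable]: "G \<in> sets MY" for G
  proof -
    let ?g = "\<lambda>y. indicator G (fst y) * indicator C (snd y) :: ennreal"
    have "(\<integral>\<^sup>+ p. ?g (Y p) * f p \<partial>(A \<Otimes>\<^sub>M B)) = (\<integral>\<^sup>+ p. ?g (Y p) * cond f (Y p) \<partial>(A \<Otimes>\<^sub>M B))"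
      by (subst nn_integral_cond) (simp_all add: nn_integral_law)
    then show ?thesis
      using fub1[of "\<lambda>a. indicator G (\<phi> a)"] fub2[of "\<lambda>a. indicator G (\<phi> a)"]
      by (simp add: Y_def)
  qed
  have "density ?L H1 = density ?L H2"
    by (rule measure_eqI)
       (simp_all add: emeasure_density nn_integral_distr int mult.commute[of _ "indicator _ _"])
  moreover have "(\<integral>\<^sup>+ y. H1 y \<partial>?L) \<noteq> \<infinity>"
  proof -
    have "H1 y \<le> (\<integral>\<^sup>+ b. 1 \<partial>B)" for y
      unfolding H1_def by (rule nn_integral_mono) (auto simp: indicator_def le)
    then have "(\<integral>\<^sup>+ y. H1 y \<partial>?L) \<le> (\<integral>\<^sup>+ y. 1 \<partial>?L)"
      by (intro nn_integral_mono) (simp add: B.emeasure_space_1)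
    also have "\<dots> = 1" by (simp add: L.emeasure_space_1 del: space_distr)
    finally show ?thesis by (auto simp: top_unique)
  qed
  ultimately have "AE y in ?L. H1 y = H2 y"
    by (subst (asm) finite_density_unique) auto
  then have "AE a in A. H1 (\<phi> a) = H2 (\<phi> a)"
    by (simp add: AE_distr_iff)
  then have "(\<integral>\<^sup>+ a. indicator S a * H1 (\<phi> a) \<partial>A) = (\<integral>\<^sup>+ a. indicator S a * H2 (\<phi> a) \<partial>A)"
    by (intro nn_integral_cong_AE) (auto elim!: eventually_mono)
  then show ?thesis using fub1[of "indicator S"] fub2[of "indicator S"] by simp
qed

text \<open>Both sides are integrals of \<^term>\<open>\<theta>\<close> with respect to finite measures on a product, which agree as
  they agree on rectangles.\<close>

lemma nn_integral_cond_snd: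
  fixes h' :: "'b \<times> 'y \<Rightarrow> ennreal" and \<theta> :: "'a \<times> 'z \<Rightarrow> ennreal"
  assumes h' [measurable]: "h' \<in> borel_measurable (B \<Otimes>\<^sub>M MY)" and le: "\<And>p. h' p \<le> 1"
    and \<theta> [measurable]: "\<theta> \<in> borel_measurable (A \<Otimes>\<^sub>M MY')"
  defines "f \<equiv> \<lambda>p. h' (snd p, \<phi> (fst p))"
  shows "(\<integral>\<^sup>+ p. \<theta> (fst p, \<phi>' (snd p)) * f p \<partial>(A \<Otimes>\<^sub>M B)) =
    (\<integral>\<^sup>+ p. \<theta> (fst p, \<phi>' (snd p)) * cond f (Y p) \<partial>(A \<Otimes>\<^sub>M B))"
proof -
  have f [measurable]: "f \<in> borel_measurable (A \<Otimes>\<^sub>M B)" unfolding f_def by measurable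
  let ?T = "\<lambda>p. (fst p, \<phi>' (snd p))"
  let ?m = "\<lambda>f. distr (density (A \<Otimes>\<^sub>M B) f) (A \<Otimes>\<^sub>M MY') ?T"
  have [measurable]: "?T \<in> measurable (A \<Otimes>\<^sub>M B) (A \<Otimes>\<^sub>M MY')" by measurable
  have em: "emeasure (?m u) (S \<times> C) =
      (\<integral>\<^sup>+ p. indicator S (fst p) * indicator C (\<phi>' (snd p)) * u p \<partial>(A \<Otimes>\<^sub>M B))"
    if [measurable]: "u \<in> borel_measurable (A \<Otimes>\<^sub>M B)" "S \<in> sets A" "C \<in> sets MY'" for u S C
    by (auto simp: emeasure_distr emeasure_density indicator_def intro!: nn_integral_cong)
  have "?m f = ?m (\<lambda>p. cond f (Y p))"
  proof (rule measure_eqI_generator_eq)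
    let ?E = "{S \<times> C | S C. S \<in> sets A \<and> C \<in> sets MY'}" and ?\<Omega> = "space A \<times> space MY'"
    show "Int_stable ?E" by (rule Int_stable_pair_measure_generator)
    show "?E \<subseteq> Pow ?\<Omega>" by (auto dest: sets.sets_into_space)
    show "sets (?m f) = sigma_sets ?\<Omega> ?E" "sets (?m (\<lambda>p. cond f (Y p))) = sigma_sets ?\<Omega> ?E"
      by (simp_all add: sets_pair_measure)
    show "range (\<lambda>_::nat. ?\<Omega>) \<subseteq> ?E" "(\<Union>i::nat. ?\<Omega>) = ?\<Omega>" by auto
    show "emeasure (?m f) X = emeasure (?m (\<lambda>p. cond f (Y p))) X" if X_in: "X \<in> ?E" for X
    proof -
      obtain S C where X: "X = S \<times> C" "S \<in> sets A" "C \<in> sets MY'" using X_in by blast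
      have "(\<integral>\<^sup>+ p. indicator S (fst p) * indicator C (\<phi>' (snd p)) * f p \<partial>(A \<Otimes>\<^sub>M B)) =
          (\<integral>\<^sup>+ p. indicator S (fst p) * indicator C (\<phi>' (snd p)) * cond f (Y p) \<partial>(A \<Otimes>\<^sub>M B))"
        unfolding f_def by (rule nn_integral_cond_snd_rect[OF h' le X(2,3)])
      then show ?thesis using X(2,3) by (simp add: X(1) em)
    qed
    have "emeasure (?m f) ?\<Omega> = (\<integral>\<^sup>+ p. f p \<partial>(A \<Otimes>\<^sub>M B))"
      using measurable_space[OF \<phi>'] by (subst em) (auto intro!: nn_integral_cong simp: indicator_def space_pair_measure)
    also have "\<dots> \<le> (\<integral>\<^sup>+ p. 1 \<partial>(A \<Otimes>\<^sub>M B))"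
      by (intro nn_integral_mono) (simp add: f_def le)
    also have "\<dots> = 1" by (simp add: AB.emeasure_space_1)
    finally show "emeasure (?m f) ?\<Omega> \<noteq> \<infinity>" for i :: nat by (auto simp: top_unique)
  qed
  then have "(\<integral>\<^sup>+ q. \<theta> q \<partial>?m f) = (\<integral>\<^sup>+ q. \<theta> q \<partial>?m (\<lambda>p. cond f (Y p)))" by simp
  then show ?thesis by (simp add: nn_integral_distr nn_integral_density mult.commute)
qed

text \<open>Each factor knows the other family only through \<^term>\<open>Y\<close>, so conditioning on \<^term>\<open>Y\<close> is
  multiplicative.\<close>

proposition nn_integral_cond_product:
  fixes h :: "'a \<times> 'z \<Rightarrow> ennreal" and h' :: "'b \<times> 'y \<Rightarrow> ennreal"
  assumes h [measurable]: "h \<in> borel_measurable (A \<Otimes>\<^sub>M MY')"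
    and h' [measurable]: "h' \<in> borel_measurable (B \<Otimes>\<^sub>M MY)" and le: "\<And>p. h' p \<le> 1"
    and g [measurable]: "g \<in> borel_measurable (MY \<Otimes>\<^sub>M MY')"
  defines "f \<equiv> \<lambda>p. h (fst p, \<phi>' (snd p))" and "f' \<equiv> \<lambda>p. h' (snd p, \<phi> (fst p))"
  shows "(\<integral>\<^sup>+ p. g (Y p) * (f p * f' p) \<partial>(A \<Otimes>\<^sub>M B)) = (\<integral>\<^sup>+ y. g y * (cond f y * cond f' y) \<partial>law)"
proof -
  have [measurable]: "f \<in> borel_measurable (A \<Otimes>\<^sub>M B)" unfolding f_def by measurable
  let ?\<theta> = "\<lambda>q. g (\<phi> (fst q), snd q) * h q"
  have "(\<integral>\<^sup>+ p. g (Y p) * (f p * f' p) \<partial>(A \<Otimes>\<^sub>M B)) =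
      (\<integral>\<^sup>+ p. ?\<theta> (fst p, \<phi>' (snd p)) * f' p \<partial>(A \<Otimes>\<^sub>M B))"
    by (simp add: Y_def f_def mult.assoc)
  also have "\<dots> = (\<integral>\<^sup>+ p. ?\<theta> (fst p, \<phi>' (snd p)) * cond f' (Y p) \<partial>(A \<Otimes>\<^sub>M B))"
    unfolding f'_def by (rule nn_integral_cond_snd) (use le in auto)
  also have "\<dots> = (\<integral>\<^sup>+ p. (g (Y p) * cond f' (Y p)) * f p \<partial>(A \<Otimes>\<^sub>M B))"
    by (simp add: Y_def f_def ac_simps)
  also have "\<dots> = (\<integral>\<^sup>+ y. (g y * cond f' y) * cond f y \<partial>law)"
    by (rule nn_integral_cond) auto
  finally show ?thesis by (simp add: ac_simps)
qed

end

section \<open>Regular conditional probabilities\<close>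

locale conditioned = prob_space P
  for P :: "'a measure" +
  fixes N :: "'b measure" and Y :: "'a \<Rightarrow> 'b" and \<kappa> :: "'b \<Rightarrow> 'a measure"
  assumes Y [measurable]: "Y \<in> measurable P N"
    and rcp: "regular_conditional_prob P N Y \<kappa>"
begin

abbreviation Q :: "'b measure" where
  "Q \<equiv> distr P N Y"

lemma emeasure_Int_eq:
  "A \<in> sets P \<Longrightarrow> B \<in> sets N \<Longrightarrow>
    emeasure P (A \<inter> (Y -` B \<inter> space P)) = (\<integral>\<^sup>+ y\<in>B. emeasure (\<kappa> y) A \<partial>Q)"
  using rcp by (simp add: regular_conditional_prob_def)

lemma kernel_measurable: "\<kappa> \<in> measurable N (prob_algebra P)"
  using rcp by (simp add: regular_conditional_prob_def)

lemma kernel_prob_space: "y \<in> space N \<Longrightarrow> prob_space (\<kappa> y)"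
  and sets_kernel: "y \<in> space N \<Longrightarrow> sets (\<kappa> y) = sets P"
  using measurable_space[OF kernel_measurable] by (auto simp: space_prob_algebra)

lemma space_kernel: "y \<in> space N \<Longrightarrow> space (\<kappa> y) = space P"
  using sets_eq_imp_space_eq[OF sets_kernel] .

lemma measurable_emeasure_kernel [measurable]:
  assumes "A \<in> sets P"
  shows "(\<lambda>y. emeasure (\<kappa> y) A) \<in> borel_measurable N"
  using measurable_compose[OF measurable_prob_algebraD[OF kernel_measurable]
      measurable_emeasure_subprob_algebra[OF assms]] .

lemma kernel_space: "y \<in> space N \<Longrightarrow> emeasure (\<kappa> y) (space P) = 1"
  using prob_space.emeasure_space_1[OF kernel_prob_space] by (simp add: space_kernel)

lemma kernel_Compl:
  assumes y: "y \<in> space N" and A: "A \<in> sets P"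
  shows "emeasure (\<kappa> y) (space P - A) = 0 \<longleftrightarrow> emeasure (\<kappa> y) A = 1"
proof -
  interpret K: prob_space "\<kappa> y" by (rule kernel_prob_space[OF y])
  have "A \<in> K.events" using A by (simp add: sets_kernel[OF y])
  then show ?thesis
    using K.prob_compl[of A] by (simp add: space_kernel[OF y] K.emeasure_eq_measure)
qed

lemma AE_kernel_eq_0:
  assumes A [measurable]: "A \<in> sets P" and B [measurable]: "B \<in> sets N"
    and 0: "emeasure P (A \<inter> (Y -` B \<inter> space P)) = 0"
  shows "AE y in Q. y \<in> B \<longrightarrow> emeasure (\<kappa> y) A = 0"
proof -
  have "(\<integral>\<^sup>+ y. emeasure (\<kappa> y) A * indicator B y \<partial>Q) = 0"
    using emeasure_Int_eq[OF A B] 0 by simp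
  then have "AE y in Q. emeasure (\<kappa> y) A * indicator B y = 0"
    by (subst (asm) nn_integral_0_iff_AE) auto
  then show ?thesis by eventually_elim (auto simp: indicator_def split: if_splits)
qed

lemma AE_kernel:
  assumes "AE z in P. R z"
  shows "AE y in Q. AE z in \<kappa> y. R z"
proof -
  obtain A where A: "{z \<in> space P. \<not> R z} \<subseteq> A" "emeasure P A = 0" "A \<in> sets P"
    using assms by (rule AE_E)
  have "AE y in Q. y \<in> space N \<longrightarrow> emeasure (\<kappa> y) A = 0"
    using A(2) sets.sets_into_space[OF A(3)] measurable_space[OF Y]
    by (intro AE_kernel_eq_0 A(3)) (auto simp: Int_absorb2 subset_eq)
  moreover have "AE y in Q. y \<in> space N" using AE_space[of Q] by simp
  ultimately show ?thesis
  proof eventually_elim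
    case (elim y)
    then show ?case
      using A by (intro AE_I[of _ _ A]) (auto simp: space_kernel sets_kernel)
  qed
qed

lemma AE_kernel_mem:
  assumes B [measurable]: "B \<in> sets N"
  shows "AE y in Q. y \<in> B \<longrightarrow> (AE z in \<kappa> y. Y z \<in> B)"
proof -
  let ?A = "Y -` (space N - B) \<inter> space P"
  have A: "?A \<in> sets P" by measurable
  have e: "?A \<inter> (Y -` B \<inter> space P) = {}" by auto
  have "AE y in Q. y \<in> B \<longrightarrow> emeasure (\<kappa> y) ?A = 0"
    by (rule AE_kernel_eq_0[OF A B]) (simp only: e emeasure_empty)
  moreover have "AE y in Q. y \<in> space N" using AE_space[of Q] by simp
  ultimately show ?thesis
  proof eventually_elim
    case (elim y)
    then show ?case
      using A measurable_space[OF Y] by (auto intro!: AE_I[of _ _ ?A] simp: space_kernel sets_kernel)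
  qed
qed

text \<open>Since \<^term>\<open>s\<close> has a left inverse, conditioning on \<^term>\<open>s (Y z)\<close> is the same as conditioning on
  \<^term>\<open>Y z\<close>.\<close>

lemma conditioned_relabel:
  assumes s [measurable]: "s \<in> measurable N N'" and c [measurable]: "c \<in> measurable N' N"
    and cs: "\<And>y. y \<in> space N \<Longrightarrow> c (s y) = y"
  shows "conditioned P N' (\<lambda>z. s (Y z)) (\<lambda>y. \<kappa> (c y))"
proof
  have "(\<lambda>y. \<kappa> (c y)) \<in> measurable N' (prob_algebra P)"
    using measurable_compose[OF c kernel_measurable] .
  moreover have "emeasure P (A \<inter> ((\<lambda>z. s (Y z)) -` B \<inter> space P)) =
      (\<integral>\<^sup>+ y\<in>B. emeasure (\<kappa> (c y)) A \<partial>distr P N' (\<lambda>z. s (Y z)))"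
    if [measurable]: "A \<in> sets P" "B \<in> sets N'" for A B
  proof -
    have "(\<integral>\<^sup>+ y\<in>B. emeasure (\<kappa> (c y)) A \<partial>distr P N' (\<lambda>z. s (Y z))) =
        (\<integral>\<^sup>+ z. emeasure (\<kappa> (c (s (Y z)))) A * indicator B (s (Y z)) \<partial>P)"
      by (rule nn_integral_distr) measurable
    also have "\<dots> = (\<integral>\<^sup>+ z. emeasure (\<kappa> (Y z)) A * indicator (s -` B \<inter> space N) (Y z) \<partial>P)"
      using measurable_space[OF Y] by (intro nn_integral_cong) (auto simp: cs indicator_def)
    also have "\<dots> = (\<integral>\<^sup>+ y\<in>(s -` B \<inter> space N). emeasure (\<kappa> y) A \<partial>Q)"
      by (rule nn_integral_distr[symmetric]) measurable
    also have "\<dots> = emeasure P (A \<inter> (Y -` (s -` B \<inter> space N) \<inter> space P))"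
      by (rule emeasure_Int_eq[symmetric]) measurable
    also have "Y -` (s -` B \<inter> space N) \<inter> space P = (\<lambda>z. s (Y z)) -` B \<inter> space P"
      using measurable_space[OF Y] by auto
    finally show ?thesis by simp
  qed
  ultimately show "regular_conditional_prob P N' (\<lambda>z. s (Y z)) (\<lambda>y. \<kappa> (c y))"
    by (simp add: regular_conditional_prob_def)
qed measurable

end

text \<open>Countably many half-spaces with rational bounds determine a point.\<close>

lemma AE_kernel_point:
  fixes Y :: "'a \<Rightarrow> 'v::finite \<Rightarrow> real"
  assumes "conditioned P (borel_on K) Y \<kappa>"
  shows "AE y in distr P (borel_on K) Y. AE z in \<kappa> y. \<forall>k\<in>K. Y z k = y k"
proof -
  interpret conditioned P "borel_on K" Y \<kappa> by fact
  let ?B = "\<lambda>k q. {y \<in> space (borel_on K). y k < of_rat q}"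
  let ?C = "\<lambda>k q. {y \<in> space (borel_on K). \<not> y k < of_rat q}"
  have sets [measurable]: "?B k q \<in> sets (borel_on K)" "?C k q \<in> sets (borel_on K)" if "k \<in> K" for k q
    using that by measurable
  have mem: "AE y in Q. (y \<in> ?B k q \<longrightarrow> (AE z in \<kappa> y. Y z \<in> ?B k q)) \<and>
      (y \<in> ?C k q \<longrightarrow> (AE z in \<kappa> y. Y z \<in> ?C k q))" if "k \<in> K" for k q
    using AE_kernel_mem[OF sets(1)[OF that]] AE_kernel_mem[OF sets(2)[OF that]] by (rule AE_conjI)
  have "AE y in Q. \<forall>k\<in>K. \<forall>q. (y \<in> ?B k q \<longrightarrow> (AE z in \<kappa> y. Y z \<in> ?B k q)) \<and>
      (y \<in> ?C k q \<longrightarrow> (AE z in \<kappa> y. Y z \<in> ?C k q))"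
    by (intro AE_finite_allI finite) (simp only: AE_all_countable, intro allI mem)
  moreover have "AE y in Q. y \<in> space (borel_on K)" using AE_space[of Q] by simp
  ultimately show ?thesis
  proof eventually_elim
    case (elim y)
    have "AE z in \<kappa> y. \<forall>k\<in>K. \<forall>q. Y z k < of_rat q \<longleftrightarrow> y k < of_rat q"
      unfolding AE_all_countable
    proof (intro AE_finite_allI finite, unfold AE_all_countable, intro allI)
      fix k q assume k: "k \<in> K"
      show "AE z in \<kappa> y. Y z k < of_rat q \<longleftrightarrow> y k < of_rat q"
      proof (cases "y k < of_rat q")
        case True
        then have "AE z in \<kappa> y. Y z \<in> ?B k q" using elim k by blast
        then show ?thesis by eventually_elim (use True in auto)
      next
        case False
        then have "AE z in \<kappa> y. Y z \<in> ?C k q" using elim k by blast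
        then show ?thesis by eventually_elim (use False in auto)
      qed
    qed
    then show ?case
    proof eventually_elim
      case (elim z)
      show ?case
      proof (rule ballI, rule ccontr)
        fix k assume k: "k \<in> K" "Y z k \<noteq> y k"
        then consider "Y z k < y k" | "y k < Y z k" by linarith
        then show False
        proof cases
          case 1
          then obtain q where "Y z k < of_rat q" "of_rat q < y k" using of_rat_dense by blast
          then show False using bspec[OF elim k(1), THEN spec, of q] by auto
        next
          case 2
          then obtain q where "y k < of_rat q" "of_rat q < Y z k" using of_rat_dense by blast
          then show False using bspec[OF elim k(1), THEN spec, of q] by auto
        qed
      qed
    qed
  qed
qed

text \<open>Read \<^term>\<open>a\<close>, \<^term>\<open>b\<close>, \<^term>\<open>b'\<close> as conditional probabilities obtained by normalising products
  with the total weight \<^term>\<open>\<rho>\<close>: if the weight and all numerators factorise, so do the normalised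
  values.\<close>

lemma ennreal_product_cancel:
  fixes a b b' \<rho> u v u' v' :: ennreal
  assumes "a * \<rho> = u * u'" "b * \<rho> = u * v'" "b' * \<rho> = v * u'" "\<rho> = v * v'"
    and "0 < \<rho>" "\<rho> \<noteq> \<infinity>"
  shows "a = b * b'"
proof -
  have "a * (\<rho> * \<rho>) = (a * \<rho>) * \<rho>" by (simp add: mult.assoc)
  also have "\<dots> = (u * u') * (v * v')" by (simp only: assms(1), simp only: assms(4))
  also have "\<dots> = (u * v') * (v * u')" by (simp add: ac_simps)
  also have "\<dots> = (b * b') * (\<rho> * \<rho>)" by (simp only: assms(2,3)[symmetric]) (simp add: ac_simps)
  finally show ?thesis
    using assms(5,6) mult_divide_eq_ennreal[of "\<rho> * \<rho>"]
    by (metis ennreal_mult_eq_top_iff infinity_ennreal_def less_numeral_extra(3) mult_eq_0_iff)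
qed

text \<open>Where \<^term>\<open>D\<close> has conditional probability one, conditioning on \<^term>\<open>X\<close> can be replaced by
  restricting to \<^term>\<open>D\<close> and conditioning on \<open>(\<phi> W, \<phi>' W')\<close>. There the indicator of \<^term>\<open>D\<close> is a
  product of two factors, each of which knows one of the families only through \<open>\<phi>\<close> or \<open>\<phi>'\<close>, and
  \<open>nn_integral_cond_product\<close> yields product densities with respect to the law of that pair. The law
  of \<^term>\<open>X\<close> itself has the density \<open>\<rho>\<close> there, by which one has to divide.\<close>

proposition conditionally_independent_on:
  fixes W :: "'w \<Rightarrow> 'a" and W' :: "'w \<Rightarrow> 'a" and \<phi> :: "'a \<Rightarrow> 'y" and \<phi>' :: "'a \<Rightarrow> 'z"
  assumes "conditioned M (MY \<Otimes>\<^sub>M MY') X \<kappa>"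
    and indep: "prob_space.indep_var M MW W MW' W'"
    and \<phi> [measurable]: "\<phi> \<in> measurable MW MY" and \<phi>' [measurable]: "\<phi>' \<in> measurable MW' MY'"
    and d [measurable]: "d \<in> sets (MW \<Otimes>\<^sub>M MY')" and d' [measurable]: "d' \<in> sets (MW' \<Otimes>\<^sub>M MY)"
  defines "D \<equiv> {\<omega> \<in> space M. (W \<omega>, \<phi>' (W' \<omega>)) \<in> d \<and> (W' \<omega>, \<phi> (W \<omega>)) \<in> d'}"
  assumes X_D: "\<And>\<omega>. \<omega> \<in> D \<Longrightarrow> X \<omega> = (\<phi> (W \<omega>), \<phi>' (W' \<omega>))"
    and S: "S \<in> sets MW" and S': "S' \<in> sets MW'"
  shows "AE x in distr M (MY \<Otimes>\<^sub>M MY') X. emeasure (\<kappa> x) D = 1 \<longrightarrow>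
    emeasure (\<kappa> x) (W -` S \<inter> W' -` S' \<inter> space M) =
    emeasure (\<kappa> x) (W -` S \<inter> space M) * emeasure (\<kappa> x) (W' -` S' \<inter> space M)"
proof -
  interpret conditioned M "MY \<Otimes>\<^sub>M MY'" X \<kappa> by fact
  have W [measurable]: "W \<in> measurable M MW" and W' [measurable]: "W' \<in> measurable M MW'"
    using indep by (auto dest: indep_var_rv1 indep_var_rv2)
  define A where "A = distr M MW W"
  define B where "B = distr M MW' W'"
  have sA [measurable_cong]: "sets A = sets MW" and sB [measurable_cong]: "sets B = sets MW'"
    by (simp_all add: A_def B_def)
  have joint: "A \<Otimes>\<^sub>M B = distr M (MW \<Otimes>\<^sub>M MW') (\<lambda>\<omega>. (W \<omega>, W' \<omega>))"
    using indep by (simp add: indep_var_distribution_eq A_def B_def)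
  interpret independent_pair A B MY MY' \<phi> \<phi>'
    by (rule independent_pair.intro)
       (auto simp: A_def B_def independent_pair_axioms_def intro!: prob_space_distr)
  define f where "f S p = (indicator S (fst p) * indicator d (fst p, \<phi>' (snd p)) :: ennreal)" for S p
  define f' where "f' S p = (indicator S (snd p) * indicator d' (snd p, \<phi> (fst p)) :: ennreal)" for S p
  define ev where "ev S S' = W -` S \<inter> W' -` S' \<inter> space M" for S S'
  define \<Gamma> where "\<Gamma> = {x \<in> space (MY \<Otimes>\<^sub>M MY'). emeasure (\<kappa> x) D = 1}"
  have D [measurable]: "D \<in> sets M" unfolding D_def by measurable
  have \<Gamma> [measurable]: "\<Gamma> \<in> sets (MY \<Otimes>\<^sub>M MY')" unfolding \<Gamma>_def by measurable
  have ev [measurable]: "ev S S' \<in> sets M" if [measurable]: "S \<in> sets MW" "S' \<in> sets MW'" for S S'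
    unfolding ev_def by measurable
  have star: "(\<integral>\<^sup>+ x. emeasure (\<kappa> x) (ev S S') * indicator F x \<partial>Q) =
      (\<integral>\<^sup>+ y. indicator F y * (cond (f S) y * cond (f' S') y) \<partial>law)"
    if S [measurable]: "S \<in> sets MW" and S' [measurable]: "S' \<in> sets MW'"
      and F [measurable]: "F \<in> sets (MY \<Otimes>\<^sub>M MY')" and sub: "F \<subseteq> \<Gamma>" for S S' F
  proof -
    have "emeasure M ((space M - D) \<inter> (X -` F \<inter> space M)) =
        (\<integral>\<^sup>+ x. emeasure (\<kappa> x) (space M - D) * indicator F x \<partial>Q)"
      by (rule emeasure_Int_eq) auto
    also have "\<dots> = (\<integral>\<^sup>+ x. 0 \<partial>Q)"
      using sub kernel_Compl[OF _ D] by (intro nn_integral_cong) (auto simp: \<Gamma>_def indicator_def)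
    finally have "AE \<omega> in M. \<omega> \<notin> (space M - D) \<inter> (X -` F \<inter> space M)"
      by (intro AE_not_in null_setsI) auto
    then have in_D: "AE \<omega> in M. X \<omega> \<in> F \<longrightarrow> \<omega> \<in> D"
      using AE_space[of M] by eventually_elim auto
    have "(\<integral>\<^sup>+ x. emeasure (\<kappa> x) (ev S S') * indicator F x \<partial>Q) =
        emeasure M (ev S S' \<inter> (X -` F \<inter> space M))"
      by (rule emeasure_Int_eq[symmetric]) auto
    also have "\<dots> = emeasure M (ev S S' \<inter> (X -` F \<inter> space M) \<inter> D)"
      by (rule emeasure_eq_AE) (use in_D in \<open>auto elim!: eventually_mono\<close>)
    also have "\<dots> = (\<integral>\<^sup>+ \<omega>. indicator (ev S S' \<inter> (X -` F \<inter> space M) \<inter> D) \<omega> \<partial>M)"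
      by (rule nn_integral_indicator[symmetric]) auto
    also have "\<dots> = (\<integral>\<^sup>+ \<omega>. indicator F (Y (W \<omega>, W' \<omega>)) *
        (f S (W \<omega>, W' \<omega>) * f' S' (W \<omega>, W' \<omega>)) \<partial>M)"
    proof (rule nn_integral_cong)
      fix \<omega> assume "\<omega> \<in> space M"
      then show "indicator (ev S S' \<inter> (X -` F \<inter> space M) \<inter> D) \<omega> = indicator F (Y (W \<omega>, W' \<omega>)) *
          (f S (W \<omega>, W' \<omega>) * f' S' (W \<omega>, W' \<omega>))"
        using X_D[of \<omega>] by (auto simp: f_def f'_def ev_def Y_def indicator_def D_def)
    qed
    also have "\<dots> = (\<integral>\<^sup>+ p. indicator F (Y p) * (f S p * f' S' p) \<partial>(A \<Otimes>\<^sub>M B))"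
      unfolding joint by (subst nn_integral_distr) (auto simp: f_def f'_def Y_def)
    also have "\<dots> = (\<integral>\<^sup>+ y. indicator F y * (cond (f S) y * cond (f' S') y) \<partial>law)"
      using nn_integral_cond_product[of "\<lambda>q. indicator S (fst q) * indicator d q"
          "\<lambda>q. indicator S' (fst q) * indicator d' q" "indicator F"]
      by (simp add: f_def[abs_def] f'_def[abs_def] indicator_def)
    finally show ?thesis .
  qed
  define s where "s = space MW"
  define s' where "s' = space MW'"
  have s [measurable]: "s \<in> sets MW" "s' \<in> sets MW'" by (auto simp: s_def s'_def)
  have ev_s: "ev s s' = space M" "ev S s' = W -` S \<inter> space M" "ev s S' = W' -` S' \<inter> space M"
    using measurable_space[OF W] measurable_space[OF W'] by (auto simp: ev_def s_def s'_def)
  define \<rho> where "\<rho> y = cond (f s) y * cond (f' s') y" for y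
  have [measurable]: "\<rho> \<in> borel_measurable (MY \<Otimes>\<^sub>M MY')" unfolding \<rho>_def by measurable
  have Q_law: "density Q (indicator \<Gamma>) = density law (\<lambda>y. \<rho> y * indicator \<Gamma> y)"
  proof (rule measure_eqI)
    fix F assume "F \<in> sets (density Q (indicator \<Gamma>))"
    then have F [measurable]: "F \<in> sets (MY \<Otimes>\<^sub>M MY')" by simp
    have "emeasure (density Q (indicator \<Gamma>)) F =
        (\<integral>\<^sup>+ x. emeasure (\<kappa> x) (ev s s') * indicator (F \<inter> \<Gamma>) x \<partial>Q)"
      by (subst emeasure_density)
         (auto intro!: nn_integral_cong simp: ev_s kernel_space indicator_def)
    also have "\<dots> = emeasure (density law (\<lambda>y. \<rho> y * indicator \<Gamma> y)) F"
      by (subst star) (auto simp: emeasure_density \<rho>_def indicator_def intro!: nn_integral_cong)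
    finally show "emeasure (density Q (indicator \<Gamma>)) F =
      emeasure (density law (\<lambda>y. \<rho> y * indicator \<Gamma> y)) F" .
  qed (simp add: sets_law)
  have Q_law_int: "(\<integral>\<^sup>+ x. g x * indicator \<Gamma> x \<partial>Q) = (\<integral>\<^sup>+ y. g y * (\<rho> y * indicator \<Gamma> y) \<partial>law)"
    if [measurable]: "g \<in> borel_measurable (MY \<Otimes>\<^sub>M MY')" for g
    using arg_cong[OF Q_law, of "\<lambda>m. \<integral>\<^sup>+ y. g y \<partial>m"]
    by (simp add: nn_integral_density mult.commute)
  have factor: "AE y in law. emeasure (\<kappa> y) (ev S S') * (\<rho> y * indicator \<Gamma> y) =
      cond (f S) y * cond (f' S') y * indicator \<Gamma> y"
    if [measurable]: "S \<in> sets MW" "S' \<in> sets MW'" for S S'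
  proof -
    let ?g = "\<lambda>y. emeasure (\<kappa> y) (ev S S') * (\<rho> y * indicator \<Gamma> y)"
    let ?g' = "\<lambda>y. cond (f S) y * cond (f' S') y * indicator \<Gamma> y"
    have "density law ?g = density law ?g'"
    proof (rule measure_eqI)
      fix F assume "F \<in> sets (density law ?g)"
      then have F [measurable]: "F \<in> sets (MY \<Otimes>\<^sub>M MY')" by (simp add: sets_law)
      have "emeasure (density law ?g) F =
          (\<integral>\<^sup>+ y. emeasure (\<kappa> y) (ev S S') * indicator F y * (\<rho> y * indicator \<Gamma> y) \<partial>law)"
        by (subst emeasure_density) (auto simp: ac_simps)
      also have "\<dots> = (\<integral>\<^sup>+ x. emeasure (\<kappa> x) (ev S S') * indicator F x * indicator \<Gamma> x \<partial>Q)"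
        by (rule Q_law_int[symmetric]) auto
      also have "\<dots> = (\<integral>\<^sup>+ x. emeasure (\<kappa> x) (ev S S') * indicator (F \<inter> \<Gamma>) x \<partial>Q)"
        by (intro nn_integral_cong) (auto simp: indicator_def)
      also have "\<dots> = emeasure (density law ?g') F"
        by (subst star) (auto simp: emeasure_density indicator_def intro!: nn_integral_cong)
      finally show "emeasure (density law ?g) F = emeasure (density law ?g') F" .
    qed simp
    moreover have "(\<integral>\<^sup>+ y. ?g y \<partial>law) \<noteq> \<infinity>"
    proof -
      have "(\<integral>\<^sup>+ y. ?g y \<partial>law) = (\<integral>\<^sup>+ x. emeasure (\<kappa> x) (ev S S') * indicator \<Gamma> x \<partial>Q)"
        by (rule Q_law_int[symmetric]) auto
      also have "\<dots> = emeasure M (ev S S' \<inter> (X -` \<Gamma> \<inter> space M))"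
        by (rule emeasure_Int_eq[symmetric]) auto
      finally show ?thesis by simp
    qed
    ultimately show ?thesis by (subst (asm) finite_density_unique) auto
  qed
  have "AE y in law. \<rho> y * indicator \<Gamma> y \<noteq> \<infinity>"
  proof (rule nn_integral_PInf_AE)
    have "(\<integral>\<^sup>+ y. \<rho> y * indicator \<Gamma> y \<partial>law) = (\<integral>\<^sup>+ x. indicator \<Gamma> x \<partial>Q)"
      using Q_law_int[of "\<lambda>_. 1"] by simp
    also have "\<dots> = emeasure Q \<Gamma>" by (rule nn_integral_indicator) simp
    also have "\<dots> = emeasure M (X -` \<Gamma> \<inter> space M)" by (rule emeasure_distr) auto
    finally show "(\<integral>\<^sup>+ y. \<rho> y * indicator \<Gamma> y \<partial>law) \<noteq> \<infinity>" by simp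
  qed auto
  with factor[OF S S'] factor[OF S s(2)] factor[OF s(1) S']
  have "AE y in law. 0 < \<rho> y * indicator \<Gamma> y \<longrightarrow> emeasure (\<kappa> y) (ev S S') =
      emeasure (\<kappa> y) (ev S s') * emeasure (\<kappa> y) (ev s S')"
  proof eventually_elim
    case (elim y)
    show ?case
    proof
      assume pos: "0 < \<rho> y * indicator \<Gamma> y"
      then have i: "indicator \<Gamma> y = (1 :: ennreal)" by (cases "y \<in> \<Gamma>") auto
      note e = elim[unfolded i mult_1_right]
      then show "emeasure (\<kappa> y) (ev S S') = emeasure (\<kappa> y) (ev S s') * emeasure (\<kappa> y) (ev s S')"
        using ennreal_product_cancel[OF e(1-3) \<rho>_def] pos[unfolded i mult_1_right] e(4) by blast
    qed
  qed
  then have "AE y in density law (\<lambda>y. \<rho> y * indicator \<Gamma> y). emeasure (\<kappa> y) (ev S S') =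
      emeasure (\<kappa> y) (ev S s') * emeasure (\<kappa> y) (ev s S')"
    by (subst AE_density) auto
  then have "AE y in Q. 0 < (indicator \<Gamma> y :: ennreal) \<longrightarrow> emeasure (\<kappa> y) (ev S S') =
      emeasure (\<kappa> y) (ev S s') * emeasure (\<kappa> y) (ev s S')"
    unfolding Q_law[symmetric] by (subst (asm) AE_density) auto
  moreover have "AE y in Q. y \<in> space (MY \<Otimes>\<^sub>M MY')" using AE_space[of Q] by simp
  ultimately show ?thesis
    by eventually_elim (auto simp: \<Gamma>_def ev_s, simp add: ev_def)
qed

section \<open>Conditional independence of the two groups of innovations\<close>

context innovation_network
begin

lemma measurable_restricted_coordinate [measurable]:
  "j \<in> U \<Longrightarrow> (\<lambda>w. w j) \<in> borel_measurable (PiM U \<mu>)"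
  using measurable_compose[OF measurable_component_singleton[of j U \<mu>] measurable_\<mu>_borel] by simp

lemma measurable_subvector: "subvector X I \<in> measurable P (borel_on I)"
  unfolding subvector_def by (intro measurable_restrict measurable_X)

lemma indep_coordinates:
  "P.indep_var (PiM U \<mu>) (\<lambda>z. restrict z U) (PiM (- U) \<mu>) (\<lambda>z. restrict z (- U))"
proof -
  have "P.indep_vars \<mu> (\<lambda>v z. z v) UNIV"
    by (subst P.indep_vars_iff_distr_eq_PiM') (auto simp: PiM_component distr_id2 restrict_UNIV)
  then show ?thesis by (rule P.indep_var_restrict) auto
qed

text \<open>The value 0 keeps the maximum meaningful for empty \<^term>\<open>U\<close> and is smaller than all positive
  values.\<close>

definition partial_max :: "'v set \<Rightarrow> ('v \<Rightarrow> real) \<Rightarrow> 'v \<Rightarrow> real" where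
  "partial_max U z k = Max (insert 0 ((\<lambda>j. cs k j * z j) ` U))"

lemma partial_max_restrict: "partial_max U (restrict z U) k = partial_max U z k"
  by (simp add: partial_max_def cong: image_cong)

lemma measurable_partial_max [measurable]:
  "(\<lambda>w. partial_max U w k) \<in> borel_measurable (PiM U \<mu>)"
proof (cases "U = {}")
  case False
  then have "partial_max U w k = max 0 (Max ((\<lambda>j. cs k j * w j) ` U))" for w
    by (simp add: partial_max_def)
  then show ?thesis
    using False by (simp only:) (intro borel_measurable_max borel_measurable_const borel_measurable_Max
        borel_measurable_times measurable_restricted_coordinate finite)
qed (simp add: partial_max_def)

text \<open>In this event the nodes of \<^term>\<open>L\<close> take their values from \<^term>\<open>U\<close> and the other nodes of
  \<^term>\<open>K\<close> take theirs from outside \<^term>\<open>U\<close>.\<close>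

definition split_event :: "'v set \<Rightarrow> 'v set \<Rightarrow> 'v set \<Rightarrow> ('v \<Rightarrow> real) set" where
  "split_event K U L = {z \<in> space P. (\<forall>k\<in>K - L. partial_max U z k < partial_max (- U) z k) \<and>
     (\<forall>k\<in>L. partial_max (- U) z k < partial_max U z k)}"

lemma X_eq_partial_max:
  assumes "\<And>v. 0 < z v"
  shows "X z k = max (partial_max U z k) (partial_max (- U) z k)"
proof -
  have "X z k = Max (insert 0 (range (\<lambda>j. cs k j * z j)))"
    using X_pos[of z k] assms by (simp add: max_linear_eq_Max_cs)
  also have "insert 0 (range (\<lambda>j. cs k j * z j)) =
      insert 0 ((\<lambda>j. cs k j * z j) ` U) \<union> insert 0 ((\<lambda>j. cs k j * z j) ` (- U))"
    by auto
  also have "Max \<dots> = max (partial_max U z k) (partial_max (- U) z k)"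
    unfolding partial_max_def by (rule Max_Un) auto
  finally show ?thesis .
qed

lemma partial_max_src_less:
  assumes gen: "generic z" and "src z k \<notin> U"
  shows "partial_max U z k < partial_max (- U) z k"
proof -
  have "cs k j * z j < X z k" if "j \<in> U" for j
    using that assms(2) src_less[OF gen, of j k] by auto
  then have "partial_max U z k < X z k"
    unfolding partial_max_def using X_pos[of z k] genericD[OF gen] by (subst Max_less_iff) auto
  then show ?thesis using X_eq_partial_max[of z k U] genericD[OF gen] by auto
qed

lemma split_eventI:
  assumes gen: "generic z" and "\<And>k. k \<in> K \<Longrightarrow> src z k \<in> U \<longleftrightarrow> k \<in> L" and "L \<subseteq> K"
  shows "z \<in> split_event K U L"
  using assms partial_max_src_less[OF gen] partial_max_src_less[OF gen, of _ "- U"]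
  by (auto simp: split_event_def space_P genericD)

text \<open>Rational corners make the boxes a countable family, so that countably many almost sure identities
  suffice to obtain the independence of the generated \<open>\<sigma>\<close>-algebras.\<close>

definition lower_box :: "'v set \<Rightarrow> ('v \<Rightarrow> rat) \<Rightarrow> ('v \<Rightarrow> real) set" where
  "lower_box U q = {z \<in> space P. \<forall>j\<in>U. z j \<le> of_rat (q j)}"

lemma sets_lower_box [measurable]: "lower_box U q \<in> sets P"
  unfolding lower_box_def by measurable

lemma Int_stable_lower_boxes: "Int_stable (range (lower_box U))"
proof (rule Int_stableI_image)
  fix q r :: "'v \<Rightarrow> rat"
  have "(of_rat (min a b) :: real) = min (of_rat a) (of_rat b)" for a b
    by (simp add: min_def of_rat_less_eq)
  then have "lower_box U q \<inter> lower_box U r = lower_box U (\<lambda>j. min (q j) (r j))"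
    by (auto simp: lower_box_def)
  then show "\<exists>s\<in>UNIV. lower_box U q \<inter> lower_box U r = lower_box U s" by blast
qed

lemma measurable_coordinate_lower_boxes:
  assumes "j \<in> U"
  shows "(\<lambda>z. z j) \<in> borel_measurable (sigma (space P) (range (lower_box U)))"
proof (rule borel_measurableI_less)
  have boxes: "range (lower_box U) \<subseteq> Pow (space P)" by (auto simp: lower_box_def)
  let ?S = "sigma (space P) (range (lower_box U))"
  have le: "{z \<in> space P. z j \<le> of_rat q} \<in> sets ?S" for q
  proof -
    \<comment> \<open>the bounds on the other coordinates of the box tend to infinity\<close>
    have "{z \<in> space P. z j \<le> of_rat q} = (\<Union>n::nat. lower_box U (\<lambda>i. if i = j then q else of_nat n))"
    proof (intro set_eqI iffI)
      fix z assume z: "z \<in> {z \<in> space P. z j \<le> of_rat q}"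
      obtain n :: nat where n: "Max (range z) \<le> of_nat n" using real_arch_simple by blast
      have "z i \<le> of_nat n" for i using n Max_ge[of "range z" "z i"] by simp
      then show "z \<in> (\<Union>n::nat. lower_box U (\<lambda>i. if i = j then q else of_nat n))"
        using z by (auto simp: lower_box_def intro!: exI[of _ n])
    next
      fix z assume "z \<in> (\<Union>n::nat. lower_box U (\<lambda>i. if i = j then q else of_nat n))"
      then show "z \<in> {z \<in> space P. z j \<le> of_rat q}"
        using assms by (auto simp: lower_box_def dest!: bspec[of _ _ j])
    qed
    also have "\<dots> \<in> sets ?S"
      using boxes by (intro sets.countable_UN) (auto simp: sets_measure_of)
    finally show ?thesis .
  qed
  fix a
  have "{z \<in> space ?S. z j < a} = (\<Union>q\<in>{q. of_rat q < a}. {z \<in> space P. z j \<le> of_rat q})"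
  proof (intro set_eqI iffI)
    fix z assume z: "z \<in> {z \<in> space ?S. z j < a}"
    then obtain q where "z j < of_rat q" "of_rat q < a" using of_rat_dense by blast
    then show "z \<in> (\<Union>q\<in>{q. of_rat q < a}. {z \<in> space P. z j \<le> of_rat q})"
      using z boxes by (auto simp: space_measure_of_conv intro!: exI[of _ q])
  qed (use boxes in \<open>auto simp: space_measure_of_conv\<close>)
  also have "\<dots> \<in> sets ?S" by (intro sets.countable_UN'' le) auto
  finally show "{z \<in> space ?S. z j < a} \<in> sets ?S" .
qed

text \<open>On the split event the values on \<^term>\<open>L\<close> are functions of the innovations in \<^term>\<open>U\<close> and the
  values on \<^term>\<open>K - L\<close> are functions of the others. The event compares each group of innovations
  with values determined by the other group only.\<close>

lemma AE_lower_boxes_independent: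
  assumes "conditioned P (borel_on K) (subvector X K) \<kappa>" and L: "L \<subseteq> K"
  shows "AE x in distr P (borel_on K) (subvector X K). emeasure (\<kappa> x) (split_event K U L) = 1 \<longrightarrow>
    (\<forall>q q'. emeasure (\<kappa> x) (lower_box U q \<inter> lower_box (- U) q') =
      emeasure (\<kappa> x) (lower_box U q) * emeasure (\<kappa> x) (lower_box (- U) q'))"
proof -
  interpret conditioned P "borel_on K" "subvector X K" \<kappa> by fact
  let ?N = "borel_on L \<Otimes>\<^sub>M borel_on (K - L) :: (('v \<Rightarrow> real) \<times> ('v \<Rightarrow> real)) measure"
  define s where "s x = (restrict x L, restrict x (K - L))" for x :: "'v \<Rightarrow> real"
  define m where "m = (merge L (K - L) :: ('v \<Rightarrow> real) \<times> ('v \<Rightarrow> real) \<Rightarrow> 'v \<Rightarrow> real)"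
  have s [measurable]: "s \<in> measurable (borel_on K) ?N"
    unfolding s_def using L by (intro measurable_Pair measurable_restrict_subset) auto
  have m [measurable]: "m \<in> measurable ?N (borel_on K)"
    using measurable_merge[of L "K - L" "\<lambda>_. borel"] L by (simp add: m_def Un_absorb1)
  have ms: "m (s x) = x" if "x \<in> space (borel_on K)" for x
    using that L by (auto simp: m_def s_def merge_def fun_eq_iff space_PiM PiE_iff extensional_def)
  have relabelled: "conditioned P ?N (\<lambda>z. s (subvector X K z)) (\<lambda>y. \<kappa> (m y))"
    by (rule conditioned_relabel[OF s m ms])
  define \<phi> where "\<phi> w = (\<lambda>k\<in>L. partial_max U w k)" for w
  define \<phi>' where "\<phi>' w = (\<lambda>k\<in>K - L. partial_max (- U) w k)" for w
  have \<phi> [measurable]: "\<phi> \<in> measurable (PiM U \<mu>) (borel_on L)"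
    unfolding \<phi>_def by measurable
  have \<phi>' [measurable]: "\<phi>' \<in> measurable (PiM (- U) \<mu>) (borel_on (K - L))"
    unfolding \<phi>'_def by measurable
  define d where "d = {p \<in> space (PiM U \<mu> \<Otimes>\<^sub>M borel_on (K - L)).
    \<forall>k\<in>K - L. partial_max U (fst p) k < snd p k}"
  define d' where "d' = {p \<in> space (PiM (- U) \<mu> \<Otimes>\<^sub>M borel_on L).
    \<forall>k\<in>L. partial_max (- U) (fst p) k < snd p k}"
  have d: "d \<in> sets (PiM U \<mu> \<Otimes>\<^sub>M borel_on (K - L))" unfolding d_def by measurable
  have d': "d' \<in> sets (PiM (- U) \<mu> \<Otimes>\<^sub>M borel_on L)" unfolding d'_def by measurable
  define D where "D = {z \<in> space P. (restrict z U, \<phi>' (restrict z (- U))) \<in> d \<and>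
    (restrict z (- U), \<phi> (restrict z U)) \<in> d'}"
  have D_eq: "D = split_event K U L"
    by (auto simp: D_def d_def d'_def split_event_def \<phi>_def \<phi>'_def partial_max_restrict
        space_pair_measure space_P space_PiM space_\<mu>)
  have X_D: "s (subvector X K z) = (\<phi> (restrict z U), \<phi>' (restrict z (- U)))" if z: "z \<in> D" for z
  proof -
    have "X z k = partial_max U z k" if "k \<in> L" for k
      using z that X_eq_partial_max[of z k U] by (auto simp: D_eq split_event_def space_P)
    moreover have "X z k = partial_max (- U) z k" if "k \<in> K - L" for k
      using z that X_eq_partial_max[of z k U] by (auto simp: D_eq split_event_def space_P)
    ultimately show ?thesis
      using L by (auto simp: s_def subvector_def \<phi>_def \<phi>'_def partial_max_restrict Int_absorb1
          intro!: restrict_ext)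
  qed
  define S where "S U q = {w \<in> space (PiM U \<mu>). \<forall>j\<in>U. w j \<le> of_rat (q j)}" for U and q :: "'v \<Rightarrow> rat"
  have S: "S U q \<in> sets (PiM U \<mu>)" for U q unfolding S_def by measurable
  have S_box: "(\<lambda>z. restrict z U) -` S U q \<inter> space P = lower_box U q" for U q
    by (auto simp: S_def lower_box_def space_P space_PiM space_\<mu>)
  have split_law: "distr Q ?N s = distr P ?N (\<lambda>z. s (subvector X K z))"
    by (simp add: distr_distr comp_def measurable_subvector)
  have s': "s \<in> measurable Q ?N" by simp
  have AE_split: "AE y in distr P ?N (\<lambda>z. s (subvector X K z)). emeasure (\<kappa> (m y)) D = 1 \<longrightarrow>
      emeasure (\<kappa> (m y)) (lower_box U q \<inter> lower_box (- U) q') =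
      emeasure (\<kappa> (m y)) (lower_box U q) * emeasure (\<kappa> (m y)) (lower_box (- U) q')" for q q'
  proof -
    have eq: "(\<lambda>z. restrict z U) -` S U q \<inter> (\<lambda>z. restrict z (- U)) -` S (- U) q' \<inter> space P =
        lower_box U q \<inter> lower_box (- U) q'"
      unfolding S_box[symmetric] by auto
    show ?thesis
      by (rule conditionally_independent_on[OF relabelled indep_coordinates \<phi> \<phi>' d d' _ S[of U q]
            S[of "- U" q'], folded D_def, unfolded eq S_box]) (rule X_D)
  qed
  have "AE x in Q. emeasure (\<kappa> (m (s x))) D = 1 \<longrightarrow>
      emeasure (\<kappa> (m (s x))) (lower_box U q \<inter> lower_box (- U) q') =
      emeasure (\<kappa> (m (s x))) (lower_box U q) * emeasure (\<kappa> (m (s x))) (lower_box (- U) q')" for q q'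
    by (rule AE_distrD[OF s' AE_split[folded split_law]])
  then have "AE x in Q. \<forall>q q'. emeasure (\<kappa> (m (s x))) D = 1 \<longrightarrow>
      emeasure (\<kappa> (m (s x))) (lower_box U q \<inter> lower_box (- U) q') =
      emeasure (\<kappa> (m (s x))) (lower_box U q) * emeasure (\<kappa> (m (s x))) (lower_box (- U) q')"
    unfolding AE_all_countable by blast
  moreover have "AE x in Q. x \<in> space (borel_on K)" using AE_space[of Q] by simp
  ultimately show ?thesis
    by eventually_elim (simp add: ms D_eq)
qed

lemma indep_of_lower_boxes:
  assumes "prob_space R" and sets_R: "sets R = sets P"
    and prod: "\<And>q q'. emeasure R (lower_box U q \<inter> lower_box (- U) q') =
      emeasure R (lower_box U q) * emeasure R (lower_box (- U) q')"
  shows "prob_space.indep_set R (sigma_sets (space P) (range (lower_box U)))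
    (sigma_sets (space P) (range (lower_box (- U))))"
proof -
  interpret R: prob_space R by fact
  have sp: "space R = space P" by (rule sets_eq_imp_space_eq[OF sets_R])
  have "R.indep_set (range (lower_box U)) (range (lower_box (- U)))"
    unfolding R.indep_sets2_eq using prod
    by (auto simp: sets_R R.emeasure_eq_measure ennreal_mult'[symmetric])
  then show ?thesis
    using R.indep_set_sigma_sets[OF _ Int_stable_lower_boxes Int_stable_lower_boxes] by (simp add: sp)
qed

text \<open>A version of \<^term>\<open>subvector X I\<close> that visibly depends on the carriers of \<^term>\<open>I\<close> only. The two
  agree on the fibre.\<close>

definition fibre_value :: "'v set \<Rightarrow> ('v \<Rightarrow> real) \<Rightarrow> 'v set \<Rightarrow> ('v \<Rightarrow> real) \<Rightarrow> 'v \<Rightarrow> real" where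
  "fibre_value K x I z = (\<lambda>i\<in>I. Max (insert (least_value K x i) ((\<lambda>j. cs i j * z j) ` carriers K x i)))"

lemma fibre_value_on_fibre: "z \<in> fibre K x \<Longrightarrow> subvector X I z = fibre_value K x I z"
  unfolding subvector_def fibre_value_def by (intro restrict_ext X_on_fibre)

lemma measurable_fibre_value:
  assumes "\<And>i. i \<in> I \<Longrightarrow> carriers K x i \<subseteq> U"
  shows "fibre_value K x I \<in> measurable (sigma (space P) (range (lower_box U))) (borel_on I)"
  unfolding fibre_value_def
proof (rule measurable_restrict)
  fix i assume i: "i \<in> I"
  let ?f = "\<lambda>z. Max (insert (least_value K x i) ((\<lambda>j. cs i j * z j) ` carriers K x i))"
  let ?M = "sigma (space P) (range (lower_box U))"
  show "?f \<in> borel_measurable ?M"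
  proof (cases "carriers K x i = {}")
    case False
    then have "?f z = max (least_value K x i) (Max ((\<lambda>j. cs i j * z j) ` carriers K x i))" for z
      by simp
    moreover have "(\<lambda>z. Max ((\<lambda>j. cs i j * z j) ` carriers K x i)) \<in> borel_measurable ?M"
      using False assms[OF i]
      by (intro borel_measurable_Max borel_measurable_times borel_measurable_const
          measurable_coordinate_lower_boxes finite) auto
    ultimately show ?thesis by (simp only:) (intro borel_measurable_max borel_measurable_const)
  qed simp
qed

lemma indep_var_if_carriers_split:
  assumes "prob_space R" and sets_R: "sets R = sets P" and fibre: "AE z in R. z \<in> fibre K x"
    and prod: "\<And>q q'. emeasure R (lower_box U q \<inter> lower_box (- U) q') =
      emeasure R (lower_box U q) * emeasure R (lower_box (- U) q')"
    and I: "\<And>i. i \<in> I \<Longrightarrow> carriers K x i \<subseteq> U" and J: "\<And>j. j \<in> J \<Longrightarrow> carriers K x j \<subseteq> - U"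
  shows "prob_space.indep_var R (borel_on I) (subvector X I) (borel_on J) (subvector X J)"
proof -
  interpret R: prob_space R by fact
  have sp: "space R = space P" by (rule sets_eq_imp_space_eq[OF sets_R])
  have rv: "subvector X I \<in> measurable R (borel_on I)" for I
    using measurable_subvector by (simp add: measurable_cong_sets[OF sets_R refl])
  have sigma: "fibre_value K x I -` A \<inter> space R \<in> sigma_sets (space P) (range (lower_box U))"
    if "A \<in> sets (borel_on I)" "\<And>i. i \<in> I \<Longrightarrow> carriers K x i \<subseteq> U" for A I U
  proof -
    have boxes: "range (lower_box U) \<subseteq> Pow (space P)" by (auto simp: lower_box_def)
    show ?thesis
      using measurable_sets[OF measurable_fibre_value[of I K x U] that(1)] that(2) boxes
      by (simp add: sp space_measure_of sets_measure_of)
  qed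
  have events: "sigma_sets (space P) (range (lower_box U)) \<subseteq> R.events" for U
    unfolding sp[symmetric] by (rule sets.sigma_sets_subset) (auto simp: sets_R)
  let ?ev = "\<lambda>I A. subvector X I -` A \<inter> space R" and ?fv = "\<lambda>I A. fibre_value K x I -` A \<inter> space R"
  have "R.prob (?ev I A \<inter> ?ev J B) = R.prob (?ev I A) * R.prob (?ev J B)"
    if A: "A \<in> sets (borel_on I)" and B: "B \<in> sets (borel_on J)" for A B
  proof -
    note sA = sigma[OF A I] and sB = sigma[OF B J]
    have eA: "?ev I A \<in> R.events" "?fv I A \<in> R.events" and eB: "?ev J B \<in> R.events" "?fv J B \<in> R.events"
      using measurable_sets[OF rv] A B sA sB events by auto
    have ae: "AE z in R. z \<in> ?ev I A \<longleftrightarrow> z \<in> ?fv I A" "AE z in R. z \<in> ?ev J B \<longleftrightarrow> z \<in> ?fv J B"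
      using fibre by (auto simp: fibre_value_on_fibre elim!: eventually_mono)
    then have "AE z in R. z \<in> ?ev I A \<inter> ?ev J B \<longleftrightarrow> z \<in> ?fv I A \<inter> ?fv J B"
      by eventually_elim auto
    then have "R.prob (?ev I A \<inter> ?ev J B) = R.prob (?fv I A \<inter> ?fv J B)"
      using eA eB by (intro measure_eq_AE) auto
    also have "\<dots> = R.prob (?fv I A) * R.prob (?fv J B)"
      by (rule R.indep_setD[OF indep_of_lower_boxes[OF assms(1) sets_R prod] sA sB])
    also have "\<dots> = R.prob (?ev I A) * R.prob (?ev J B)"
      using measure_eq_AE[OF ae(1) eA] measure_eq_AE[OF ae(2) eB] by simp
    finally show ?thesis .
  qed
  then have "R.indep_set {?ev I A | A. A \<in> sets (borel_on I)} {?ev J B | B. B \<in> sets (borel_on J)}"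
    unfolding R.indep_sets2_eq using measurable_sets[OF rv] by auto
  moreover have "Int_stable {?ev I A | A. A \<in> sets (borel_on I)}" for I
  proof (rule Int_stableI)
    fix a b assume "a \<in> {?ev I A | A. A \<in> sets (borel_on I)}" "b \<in> {?ev I A | A. A \<in> sets (borel_on I)}"
    then obtain A B where "a = ?ev I A" "b = ?ev I B" "A \<in> sets (borel_on I)" "B \<in> sets (borel_on I)"
      by blast
    then show "a \<inter> b \<in> {?ev I A | A. A \<in> sets (borel_on I)}"
      by (intro CollectI exI[of _ "A \<inter> B"]) auto
  qed
  ultimately show ?thesis
    unfolding R.indep_var_eq using rv by (intro conjI R.indep_set_sigma_sets)
qed

lemma AE_kernel_fibre:
  assumes "conditioned P (borel_on K) (subvector X K) \<kappa>"
  shows "AE x in distr P (borel_on K) (subvector X K). AE z in \<kappa> x. z \<in> fibre K x"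
proof -
  interpret conditioned P "borel_on K" "subvector X K" \<kappa> by fact
  show ?thesis
    using AE_kernel[OF AE_generic] AE_kernel_point[OF assms]
  proof eventually_elim
    case (elim x)
    from elim show ?case by eventually_elim (auto simp: fibre_def subvector_def)
  qed
qed

lemma sets_split_event [measurable]: "split_event K U L \<in> sets P"
proof -
  have "(\<lambda>z. restrict z V) \<in> measurable P (PiM V \<mu>)" for V
    by (rule measurable_restrict_subset) simp
  then have [measurable]: "(\<lambda>z. partial_max V z k) \<in> borel_measurable P" for V k
    using measurable_compose[OF _ measurable_partial_max[of V k], of "\<lambda>z. restrict z V" P]
    by (simp add: partial_max_restrict)
  show ?thesis unfolding split_event_def by measurable
qed

text \<open>There are only finitely many pairs of sets \<open>U\<close> and \<open>L\<close>, so one null set serves all of them, although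
  the pair that separates \<^term>\<open>I\<close> from \<^term>\<open>J\<close> depends on \<open>x\<close>.\<close>

theorem source_dag_separation:
  assumes cond: "conditioned P (borel_on K) (subvector X K) \<kappa>"
  shows "AE x in distr P (borel_on K) (subvector X K). \<forall>I J.
    I \<inter> J = {} \<and> I \<inter> K = {} \<and> J \<inter> K = {} \<and>
    (\<forall>i\<in>I. \<forall>j\<in>J. \<not> star_connected (source_dag E c \<mu> K x) K i j) \<longrightarrow>
    prob_space.indep_var (\<kappa> x) (borel_on I) (subvector X I) (borel_on J) (subvector X J)"
proof -
  interpret conditioned P "borel_on K" "subvector X K" \<kappa> by (rule cond)
  have "AE x in Q. \<forall>U\<in>UNIV. \<forall>L\<in>Pow K. emeasure (\<kappa> x) (split_event K U L) = 1 \<longrightarrow>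
      (\<forall>q q'. emeasure (\<kappa> x) (lower_box U q \<inter> lower_box (- U) q') =
        emeasure (\<kappa> x) (lower_box U q) * emeasure (\<kappa> x) (lower_box (- U) q'))"
    by (intro AE_finite_allI finite AE_lower_boxes_independent[OF cond]) simp
  moreover have "AE x in Q. x \<in> space (borel_on K)" using AE_space[of Q] by simp
  ultimately show ?thesis
    using AE_kernel_fibre[OF cond]
  proof eventually_elim
    case (elim x)
    interpret \<kappa>x: prob_space "\<kappa> x" using elim(2) by (rule kernel_prob_space)
    note sets_\<kappa>x = sets_kernel[OF elim(2)]
    have ne: "fibre K x \<noteq> {}"
    proof
      assume "fibre K x = {}"
      then show False using elim(3) by simp
    qed
    show ?case
    proof (intro impI allI, elim conjE)
      fix I J assume disj: "I \<inter> J = {}" "I \<inter> K = {}" "J \<inter> K = {}"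
        and sep: "\<forall>i\<in>I. \<forall>j\<in>J. \<not> star_connected (source_dag E c \<mu> K x) K i j"
      have "\<exists>U L. L \<subseteq> K \<and> (\<forall>i\<in>I. carriers K x i \<subseteq> U) \<and> (\<forall>j\<in>J. carriers K x j \<subseteq> - U) \<and>
          (\<forall>z\<in>fibre K x. \<forall>k\<in>K. src z k \<in> U \<longleftrightarrow> k \<in> L)"
        by (rule separating_split[OF _ disj ne]) (use sep in blast)
      then obtain U L where L: "L \<subseteq> K" and I: "\<forall>i\<in>I. carriers K x i \<subseteq> U"
        and J: "\<forall>j\<in>J. carriers K x j \<subseteq> - U"
        and src: "\<forall>z\<in>fibre K x. \<forall>k\<in>K. src z k \<in> U \<longleftrightarrow> k \<in> L"
        by blast
      have "AE z in \<kappa> x. z \<in> split_event K U L"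
        using elim(3)
      proof eventually_elim
        case (elim z)
        show ?case by (rule split_eventI[OF fibreD(1)[OF elim] _ L]) (use src elim in blast)
      qed
      then have "emeasure (\<kappa> x) (split_event K U L) = 1"
        using \<kappa>x.emeasure_eq_1_AE[of "split_event K U L"] sets_split_event sets_\<kappa>x by simp
      then have prod: "emeasure (\<kappa> x) (lower_box U q \<inter> lower_box (- U) q') =
          emeasure (\<kappa> x) (lower_box U q) * emeasure (\<kappa> x) (lower_box (- U) q')" for q q'
        using elim(1) L by blast
      show "prob_space.indep_var (\<kappa> x) (borel_on I) (subvector X I) (borel_on J) (subvector X J)"
        by (rule indep_var_if_carriers_split[OF \<kappa>x.prob_space_axioms sets_\<kappa>x elim(3) prod])
           (use I J in blast)+
    qed
  qed
qed

end

theorem theorem5p12: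
  fixes E :: "('v::finite \<times> 'v) set"
    and c :: "'v \<Rightarrow> 'v \<Rightarrow> real"
    and \<mu> :: "'v \<Rightarrow> real measure"
    and K :: "'v set"
    and \<kappa> :: "('v \<Rightarrow> real) \<Rightarrow> ('v \<Rightarrow> real) measure"
  defines "X \<equiv> max_linear E c"
    and "P \<equiv> innovation_space \<mu>"
  assumes "weighted_dag E c"
    and "\<And>v. innovation_law (\<mu> v)"
    and "regular_conditional_prob P (borel_on K) (subvector X K) \<kappa>"
  shows "AE x in distr P (borel_on K) (subvector X K).
    possible_context E c \<mu> K x \<longrightarrow>
    (\<forall>I J. I \<inter> J = {} \<and> I \<inter> K = {} \<and> J \<inter> K = {} \<and>
       (\<forall>i\<in>I. \<forall>j\<in>J. \<not> star_connected (source_dag E c \<mu> K x) K i j) \<longrightarrow>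
       prob_space.indep_var (\<kappa> x)
         (borel_on I) (subvector X I) (borel_on J) (subvector X J))"
proof -
  interpret innovation_network E c \<mu>
    using assms(3,4) by unfold_locales
  have "conditioned P (borel_on K) (subvector X K) \<kappa>"
    unfolding X_def P_def
    by unfold_locales (use assms(5) measurable_subvector in \<open>simp_all add: X_def P_def\<close>)
  from source_dag_separation[OF this[unfolded X_def P_def]] show ?thesis
    unfolding X_def P_def by (rule eventually_mono) simp
qed

end
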